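(* Let $l_0\in\mathbb N$ be the order of the element $\left(\frac{\lambda(v^{-1})}{\lambda(v)}\right)^2\in\mathbb K$ ($l_0=0$ if this order is infinite). Then $$c_{\widetilde\Gamma_1(2,l_0)}=2\,c_{\widetilde\Gamma_1(l_0)}\in H^2(\Gamma_1,\mathbb Z_{l_0}),$$ where $\mathbb Z_{l_0}=\mathbb Z/l_0\mathbb Z$ and $\mathbb Z_0:=\mathbb Z$, and $c_{\widetilde\Gamma_1(2,l_0)}$, $c_{\widetilde\Gamma_1(l_0)}$ are the cohomology classes of the central extensions $\widetilde\Gamma_1(2,l_0)$ and $\widetilde\Gamma_1(l_0)$ of $\Gamma_1$.
   Context: $\mathbb K$ is an algebraically closed field; $H$ is a finite-dimensional factorizable ribbon Hopf algebra over $\mathbb K$ with ribbon element $v$ (factorizable: $H^*\to H$, $\varphi\mapsto(\varphi\otimes\mathrm{id})(RR_{21})$ is bijective, $R$ being the universal R-matrix); $\lambda:H\to\mathbb K$ is a nonzero left integral, i.e. $h_{(1)}\lambda(h_{(2)})=\lambda(h)1_H$ for all $h\in H$. $\Gamma_1=\langle\tau_a,\tau_b\mid\tau_a\tau_b\tau_a=\tau_b\tau_a\tau_b,\ (\tau_a\tau_b)^6=1\rangle$ is the mapping class group of the closed torus. Define $$\widetilde\Gamma_1(2,l_0)=\langle\tau_a,\tau_b,T\mid\tau_a\tau_b\tau_a=\tau_b\tau_a\tau_b,\ (\tau_a\tau_b)^6=T^2,\ T^{l_0}=1,\ T\text{ central}\rangle,$$ $$\widetilde\Gamma_1(l_0)=\langle\tau_a,\tau_b,T\mid\tau_a\tau_b\tau_a=\tau_b\tau_a\tau_b,\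 (\tau_a\tau_b)^6=T,\ T^{l_0}=1,\ T\text{ central}\rangle,$$ where $T^0$ is the empty word. Both are central extensions of $\Gamma_1$ via $\tau_a\mapsto\tau_a$, $\tau_b\mapsto\tau_b$, $T\mapsto1$, with kernel $\langle T\mid T^{l_0}=1\rangle$ identified with $\mathbb Z_{l_0}$ by $T\mapsto1$. *)

theory Defs
  imports
    "HOL-Algebra.Multiplicative_Group"
    "HOL-Algebra.Elementary_Groups"
    "HOL-Algebra.Product_Groups"
    "HOL-Computational_Algebra.Polynomial"
    "HOL-Library.Multiset"
begin

section \<open>Tensors\<close>

text \<open>
  A multiset \<open>{#(x\<^sub>1,y\<^sub>1), \<dots>, (x\<^sub>n,y\<^sub>n)#}\<close> stands for the tensor
  \<open>x\<^sub>1 \<otimes> y\<^sub>1 + \<dots> + x\<^sub>n \<otimes> y\<^sub>n\<close>.  The space \<open>H \<otimes> H\<close> is the free commutative monoid on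
  \<open>H \<times> H\<close> modulo the congruence \<open>tensor2_eq\<close> generated by the bilinearity relations; the quotient
  is automatically a vector space, with \<open>c (x \<otimes> y) = c x \<otimes> y\<close>.  Throughout, an element of
  \<open>H \<otimes> H\<close> is given by a representing multiset and equality in \<open>H \<otimes> H\<close> is \<open>tensor2_eq\<close>; likewise
  for \<open>H \<otimes> H \<otimes> H\<close>, multisets of triples and \<open>tensor3_eq\<close>.
\<close>

inductive mset_cong :: "('t multiset \<Rightarrow> 't multiset \<Rightarrow> bool) \<Rightarrow> 't multiset \<Rightarrow> 't multiset \<Rightarrow> bool"
  for B where
  base: "B X Y \<Longrightarrow> mset_cong B X Y"
| refl: "mset_cong B X X"
| sym: "mset_cong B X Y \<Longrightarrow> mset_cong B Y X"
| trans: "mset_cong B X Y \<Longrightarrow> mset_cong B Y Z \<Longrightarrow> mset_cong B X Z"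
| add: "mset_cong B X Y \<Longrightarrow> mset_cong B (X + Z) (Y + Z)"

inductive bilinear_rel ::
    "('k \<Rightarrow> 'h::ab_group_add \<Rightarrow> 'h) \<Rightarrow> ('h \<times> 'h) multiset \<Rightarrow> ('h \<times> 'h) multiset \<Rightarrow> bool"
  for scale where
  "bilinear_rel scale {#(x + x', y)#} {#(x, y), (x', y)#}"
| "bilinear_rel scale {#(x, y + y')#} {#(x, y), (x, y')#}"
| "bilinear_rel scale {#(0, y)#} {#}"
| "bilinear_rel scale {#(x, 0)#} {#}"
| "bilinear_rel scale {#(scale c x, y)#} {#(x, scale c y)#}"

inductive trilinear_rel ::
    "('k \<Rightarrow> 'h::ab_group_add \<Rightarrow> 'h) \<Rightarrow> ('h \<times> 'h \<times> 'h) multiset \<Rightarrow> ('h \<times> 'h \<times> 'h) multiset \<Rightarrow> bool"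
  for scale where
  "trilinear_rel scale {#(x + x', y, z)#} {#(x, y, z), (x', y, z)#}"
| "trilinear_rel scale {#(x, y + y', z)#} {#(x, y, z), (x, y', z)#}"
| "trilinear_rel scale {#(x, y, z + z')#} {#(x, y, z), (x, y, z')#}"
| "trilinear_rel scale {#(0, y, z)#} {#}"
| "trilinear_rel scale {#(x, 0, z)#} {#}"
| "trilinear_rel scale {#(x, y, 0)#} {#}"
| "trilinear_rel scale {#(scale c x, y, z)#} {#(x, scale c y, z)#}"
| "trilinear_rel scale {#(x, scale c y, z)#} {#(x, y, scale c z)#}"

definition tensor2_eq ::
    "('k \<Rightarrow> 'h::ab_group_add \<Rightarrow> 'h) \<Rightarrow> ('h \<times> 'h) multiset \<Rightarrow> ('h \<times> 'h) multiset \<Rightarrow> bool" where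
  "tensor2_eq scale = mset_cong (bilinear_rel scale)"

definition tensor3_eq ::
    "('k \<Rightarrow> 'h::ab_group_add \<Rightarrow> 'h) \<Rightarrow> ('h \<times> 'h \<times> 'h) multiset \<Rightarrow> ('h \<times> 'h \<times> 'h) multiset \<Rightarrow> bool" where
  "tensor3_eq scale = mset_cong (trilinear_rel scale)"

definition tensor2_mult ::
    "('h::ring_1 \<times> 'h) multiset \<Rightarrow> ('h \<times> 'h) multiset \<Rightarrow> ('h \<times> 'h) multiset" where
  "tensor2_mult X Y = (\<Sum>(a, b)\<in>#X. {#(a * c, b * d). (c, d) \<in># Y#})"

definition tensor3_mult ::
    "('h::ring_1 \<times> 'h \<times> 'h) multiset \<Rightarrow> ('h \<times> 'h \<times> 'h) multiset \<Rightarrow> ('h \<times> 'h \<times> 'h) multiset" where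
  "tensor3_mult X Y = (\<Sum>(a, b, c)\<in>#X. {#(a * a', b * b', c * c'). (a', b', c') \<in># Y#})"

definition flip :: "('h \<times> 'h) multiset \<Rightarrow> ('h \<times> 'h) multiset" where
  "flip X = image_mset prod.swap X"

definition tensor2_inverse ::
    "('k \<Rightarrow> 'h::ring_1 \<Rightarrow> 'h) \<Rightarrow> ('h \<times> 'h) multiset \<Rightarrow> ('h \<times> 'h) multiset \<Rightarrow> bool" where
  "tensor2_inverse scale X Y \<longleftrightarrow>
     tensor2_eq scale (tensor2_mult X Y) {#(1, 1)#} \<and> tensor2_eq scale (tensor2_mult Y X) {#(1, 1)#}"


section \<open>Factorizable ribbon Hopf algebras\<close>

locale fd_algebra = vector_space scale
  for scale :: "'k::field \<Rightarrow> 'h::ring_1 \<Rightarrow> 'h" +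
  assumes finite_dim: "\<exists>B. finite B \<and> span B = UNIV"
    and scale_mult_left: "scale c x * y = scale c (x * y)"
    and scale_mult_right: "x * scale c y = scale c (x * y)"

locale fd_hopf_algebra = fd_algebra scale
  for scale :: "'k::field \<Rightarrow> 'h::ring_1 \<Rightarrow> 'h" +
  fixes \<Delta> :: "'h \<Rightarrow> ('h \<times> 'h) multiset"
    and \<epsilon> :: "'h \<Rightarrow> 'k"
    and S :: "'h \<Rightarrow> 'h"
  assumes \<Delta>_add: "tensor2_eq scale (\<Delta> (x + y)) (\<Delta> x + \<Delta> y)"
    and \<Delta>_scale: "tensor2_eq scale (\<Delta> (scale c x)) {#(scale c a, b). (a, b) \<in># \<Delta> x#}"
    and \<Delta>_mult: "tensor2_eq scale (\<Delta> (x * y)) (tensor2_mult (\<Delta> x) (\<Delta> y))"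
    and \<Delta>_one: "tensor2_eq scale (\<Delta> 1) {#(1, 1)#}"
    and \<epsilon>_linear: "Vector_Spaces.linear scale (*) \<epsilon>"
    and \<epsilon>_mult: "\<epsilon> (x * y) = \<epsilon> x * \<epsilon> y"
    and \<epsilon>_one: "\<epsilon> 1 = 1"
    and coassoc: "tensor3_eq scale
          (\<Sum>(a, b)\<in>#\<Delta> x. {#(a', a'', b). (a', a'') \<in># \<Delta> a#})
          (\<Sum>(a, b)\<in>#\<Delta> x. {#(a, b', b''). (b', b'') \<in># \<Delta> b#})"
    and counit_left: "(\<Sum>(a, b)\<in>#\<Delta> x. scale (\<epsilon> a) b) = x"
    and counit_right: "(\<Sum>(a, b)\<in>#\<Delta> x. scale (\<epsilon> b) a) = x"
    and S_linear: "Vector_Spaces.linear scale scale S"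
    and antipode_left: "(\<Sum>(a, b)\<in>#\<Delta> x. S a * b) = scale (\<epsilon> x) 1"
    and antipode_right: "(\<Sum>(a, b)\<in>#\<Delta> x. a * S b) = scale (\<epsilon> x) 1"
begin

definition nonzero_left_integral :: "('h \<Rightarrow> 'k) \<Rightarrow> bool" where
  "nonzero_left_integral \<phi> \<longleftrightarrow>
     Vector_Spaces.linear scale (*) \<phi> \<and> (\<exists>h. \<phi> h \<noteq> 0) \<and>
     (\<forall>h. (\<Sum>(a, b)\<in>#\<Delta> h. scale (\<phi> b) a) = scale (\<phi> h) 1)"

end

locale quasitriangular_hopf_algebra = fd_hopf_algebra scale \<Delta> \<epsilon> S
  for scale :: "'k::field \<Rightarrow> 'h::ring_1 \<Rightarrow> 'h" and \<Delta> \<epsilon> S +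
  fixes R :: "('h \<times> 'h) multiset"
  assumes R_invertible: "\<exists>R'. tensor2_inverse scale R R'"
    and R_intertwines: "tensor2_eq scale (tensor2_mult R (\<Delta> x)) (tensor2_mult (flip (\<Delta> x)) R)"
    and \<Delta>_id_R: "tensor3_eq scale
          (\<Sum>(a, b)\<in>#R. {#(a', a'', b). (a', a'') \<in># \<Delta> a#})
          (tensor3_mult {#(a, 1, b). (a, b) \<in># R#} {#(1, a, b). (a, b) \<in># R#})"
    and id_\<Delta>_R: "tensor3_eq scale
          (\<Sum>(a, b)\<in>#R. {#(a, b', b''). (b', b'') \<in># \<Delta> b#})
          (tensor3_mult {#(a, 1, b). (a, b) \<in># R#} {#(a, b, 1). (a, b) \<in># R#})"
begin

text \<open>The Drinfeld element \<open>u = \<Sum> S(R'') R'\<close>, where \<open>R = \<Sum> R' \<otimes> R''\<close>.\<close>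

definition drinfeld :: 'h where
  "drinfeld = (\<Sum>(a, b)\<in>#R. S b * a)"

end

definition ring_inverse :: "'h::ring_1 \<Rightarrow> 'h" where
  "ring_inverse x = (THE y. x * y = 1 \<and> y * x = 1)"

locale ribbon_hopf_algebra = quasitriangular_hopf_algebra scale \<Delta> \<epsilon> S R
  for scale :: "'k::field \<Rightarrow> 'h::ring_1 \<Rightarrow> 'h" and \<Delta> \<epsilon> S R +
  fixes v :: 'h
  assumes v_invertible: "\<exists>w. v * w = 1 \<and> w * v = 1"
    and v_central: "v * x = x * v"
    and v_square: "v * v = drinfeld * S drinfeld"
    and S_v: "S v = v"
    and \<epsilon>_v: "\<epsilon> v = 1"
    and \<Delta>_v: "\<exists>Q. tensor2_inverse scale (tensor2_mult (flip R) R) Q \<and>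
                  tensor2_eq scale (\<Delta> v) (tensor2_mult Q {#(v, v)#})"

locale factorizable_ribbon_hopf_algebra = ribbon_hopf_algebra scale \<Delta> \<epsilon> S R v
  for scale :: "'k::field \<Rightarrow> 'h::ring_1 \<Rightarrow> 'h" and \<Delta> \<epsilon> S R v +
  assumes factorizable:
    "bij_betw (\<lambda>\<phi>. \<Sum>(a, b)\<in>#tensor2_mult R (flip R). scale (\<phi> a) b)
       {\<phi>. Vector_Spaces.linear scale (*) \<phi>} UNIV"

text \<open>
  In this group \<open>group.ord\<close> gives the order of a nonzero scalar, with value \<open>0\<close> for infinite order.
\<close>

definition unit_group :: "'k::field monoid" where
  "unit_group = \<lparr>carrier = UNIV - {0}, monoid.mult = (*), one = 1\<rparr>"


section \<open>Groups given by generators and relations\<close>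

text \<open>A letter \<open>(x, True)\<close> is the generator \<open>x\<close>, and \<open>(x, False)\<close> is its formal inverse.\<close>

type_synonym 'g word = "('g \<times> bool) list"

inductive word_eq :: "('g word \<times> 'g word) set \<Rightarrow> 'g word \<Rightarrow> 'g word \<Rightarrow> bool" for Rel where
  rel: "(u, w) \<in> Rel \<Longrightarrow> word_eq Rel u w"
| cancel: "word_eq Rel [(x, e), (x, \<not> e)] []"
| refl: "word_eq Rel u u"
| sym: "word_eq Rel u w \<Longrightarrow> word_eq Rel w u"
| trans: "word_eq Rel u w \<Longrightarrow> word_eq Rel w z \<Longrightarrow> word_eq Rel u z"
| append: "word_eq Rel u w \<Longrightarrow> word_eq Rel u' w' \<Longrightarrow> word_eq Rel (u @ u') (w @ w')"

definition word_class :: "('g word \<times> 'g word) set \<Rightarrow> 'g word \<Rightarrow> 'g word set" where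
  "word_class Rel u = {w. word_eq Rel u w}"

definition presented_group :: "('g word \<times> 'g word) set \<Rightarrow> 'g word set monoid" where
  "presented_group Rel =
     \<lparr>carrier = range (word_class Rel),
      monoid.mult = (\<lambda>X Y. \<Union>u\<in>X. \<Union>w\<in>Y. word_class Rel (u @ w)),
      one = word_class Rel []\<rparr>"

abbreviation pos :: "'g \<Rightarrow> 'g \<times> bool" where
  "pos x \<equiv> (x, True)"

definition generator :: "('g word \<times> 'g word) set \<Rightarrow> 'g \<Rightarrow> 'g word set" where
  "generator Rel x = word_class Rel [pos x]"

definition word_eval :: "('a, 'm) monoid_scheme \<Rightarrow> ('g \<Rightarrow> 'a) \<Rightarrow> 'g word \<Rightarrow> 'a" where
  "word_eval G f u = foldr (\<lambda>(x, e) y. (if e then f x else inv\<^bsub>G\<^esub> (f x)) \<otimes>\<^bsub>G\<^esub> y) u \<one>\<^bsub>G\<^esub>"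

text \<open>
  The homomorphism from a presented group to \<open>G\<close> sending each generator \<open>x\<close> to \<open>f x\<close>, meaningful
  when the images \<open>f x\<close> satisfy the defining relations.
\<close>

definition presented_hom :: "('a, 'm) monoid_scheme \<Rightarrow> ('g \<Rightarrow> 'a) \<Rightarrow> 'g word set \<Rightarrow> 'a" where
  "presented_hom G f X = the_elem (word_eval G f ` X)"


section \<open>The torus mapping class group and its extensions\<close>

datatype torus_gen = Tau_a | Tau_b

definition \<Gamma>1_rels :: "(torus_gen word \<times> torus_gen word) set" where
  "\<Gamma>1_rels =
     {([pos Tau_a, pos Tau_b, pos Tau_a], [pos Tau_b, pos Tau_a, pos Tau_b]),
      (concat (replicate 6 [pos Tau_a, pos Tau_b]), [])}"

definition \<Gamma>1 :: "torus_gen word set monoid" where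
  "\<Gamma>1 = presented_group \<Gamma>1_rels"

datatype ext_gen = Ext_a | Ext_b | Ext_T

text \<open>
  The sixth power of \<open>\<tau>\<^sub>a \<tau>\<^sub>b\<close> is set equal to \<open>T\<^sup>m\<close>, so that \<open>m = 2\<close> and \<open>m = 1\<close> give
  \<open>\<Gamma>\<^sub>1(2,l)\<close> and \<open>\<Gamma>\<^sub>1(l)\<close> (with tildes), respectively.
\<close>

definition ext_rels :: "nat \<Rightarrow> nat \<Rightarrow> (ext_gen word \<times> ext_gen word) set" where
  "ext_rels m l =
     {([pos Ext_a, pos Ext_b, pos Ext_a], [pos Ext_b, pos Ext_a, pos Ext_b]),
      (concat (replicate 6 [pos Ext_a, pos Ext_b]), replicate m (pos Ext_T)),
      (replicate l (pos Ext_T), []),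
      ([pos Ext_T, pos Ext_a], [pos Ext_a, pos Ext_T]),
      ([pos Ext_T, pos Ext_b], [pos Ext_b, pos Ext_T])}"

definition ext_group :: "nat \<Rightarrow> nat \<Rightarrow> ext_gen word set monoid" where
  "ext_group m l = presented_group (ext_rels m l)"

definition ext_incl :: "nat \<Rightarrow> nat \<Rightarrow> int \<Rightarrow> ext_gen word set" where
  "ext_incl m l k = generator (ext_rels m l) Ext_T [^]\<^bsub>ext_group m l\<^esub> k"

definition ext_proj :: "ext_gen word set \<Rightarrow> torus_gen word set" where
  "ext_proj = presented_hom \<Gamma>1
     (\<lambda>x. case x of Ext_a \<Rightarrow> generator \<Gamma>1_rels Tau_a
                 | Ext_b \<Rightarrow> generator \<Gamma>1_rels Tau_b
                 | Ext_T \<Rightarrow> \<one>\<^bsub>\<Gamma>1\<^esub>)"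


section \<open>Second cohomology and central extensions\<close>

text \<open>Inhomogeneous cochains with values in an abelian group \<open>A\<close> on which \<open>G\<close> acts trivially.\<close>

definition cochain2_group :: "('g, 'm) monoid_scheme \<Rightarrow> 'a monoid \<Rightarrow> ('g \<times> 'g \<Rightarrow> 'a) monoid" where
  "cochain2_group G A = product_group (carrier G \<times> carrier G) (\<lambda>_. A)"

definition cocycles2 :: "('g, 'm) monoid_scheme \<Rightarrow> 'a monoid \<Rightarrow> ('g \<times> 'g \<Rightarrow> 'a) set" where
  "cocycles2 G A =
     {f \<in> carrier (cochain2_group G A).
        \<forall>g\<in>carrier G. \<forall>h\<in>carrier G. \<forall>k\<in>carrier G.
          f (h, k) \<otimes>\<^bsub>A\<^esub> f (g, h \<otimes>\<^bsub>G\<^esub> k) = f (g \<otimes>\<^bsub>G\<^esub> h, k) \<otimes>\<^bsub>A\<^esub> f (g, h)}"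

definition coboundary1 :: "('g, 'm) monoid_scheme \<Rightarrow> 'a monoid \<Rightarrow> ('g \<Rightarrow> 'a) \<Rightarrow> 'g \<times> 'g \<Rightarrow> 'a" where
  "coboundary1 G A b =
     restrict (\<lambda>(g, h). b g \<otimes>\<^bsub>A\<^esub> b h \<otimes>\<^bsub>A\<^esub> inv\<^bsub>A\<^esub> (b (g \<otimes>\<^bsub>G\<^esub> h))) (carrier G \<times> carrier G)"

definition coboundaries2 :: "('g, 'm) monoid_scheme \<Rightarrow> 'a monoid \<Rightarrow> ('g \<times> 'g \<Rightarrow> 'a) set" where
  "coboundaries2 G A = coboundary1 G A ` (carrier G \<rightarrow> carrier A)"

definition H2 :: "('g, 'm) monoid_scheme \<Rightarrow> 'a monoid \<Rightarrow> ('g \<times> 'g \<Rightarrow> 'a) set monoid" where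
  "H2 G A = (cochain2_group G A)\<lparr>carrier := cocycles2 G A\<rparr> Mod coboundaries2 G A"

definition central_extension ::
    "'a monoid \<Rightarrow> 'e monoid \<Rightarrow> 'g monoid \<Rightarrow> ('a \<Rightarrow> 'e) \<Rightarrow> ('e \<Rightarrow> 'g) \<Rightarrow> bool" where
  "central_extension A E G i p \<longleftrightarrow>
     comm_group A \<and> group E \<and> group G \<and>
     i \<in> hom A E \<and> inj_on i (carrier A) \<and>
     p \<in> hom E G \<and> p ` carrier E = carrier G \<and>
     kernel E G p = i ` carrier A \<and>
     (\<forall>a\<in>carrier A. \<forall>x\<in>carrier E. i a \<otimes>\<^bsub>E\<^esub> x = x \<otimes>\<^bsub>E\<^esub> i a)"

text \<open>
  The cohomology class of a central extension \<open>A \<rightarrow> E \<rightarrow> G\<close>: the coset of \<open>coboundaries2 G A\<close>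
  formed by the factor sets of all set-theoretic sections \<open>s\<close> of \<open>p\<close>.
\<close>

definition extension_class ::
    "'a monoid \<Rightarrow> 'e monoid \<Rightarrow> 'g monoid \<Rightarrow> ('a \<Rightarrow> 'e) \<Rightarrow> ('e \<Rightarrow> 'g) \<Rightarrow> ('g \<times> 'g \<Rightarrow> 'a) set" where
  "extension_class A E G i p =
     {f \<in> cocycles2 G A.
        \<exists>s. s \<in> carrier G \<rightarrow> carrier E \<and> (\<forall>g\<in>carrier G. p (s g) = g) \<and>
            (\<forall>g\<in>carrier G. \<forall>h\<in>carrier G.
               s g \<otimes>\<^bsub>E\<^esub> s h = i (f (g, h)) \<otimes>\<^bsub>E\<^esub> s (g \<otimes>\<^bsub>G\<^esub> h))}"

abbreviation ext_class :: "nat \<Rightarrow> nat \<Rightarrow> (torus_gen word set \<times> torus_gen word set \<Rightarrow> int) set" where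
  "ext_class m l \<equiv>
     extension_class (integer_mod_group l) (ext_group m l) \<Gamma>1 (ext_incl m l) ext_proj"

end

theory Submission
  imports Defs
begin

text \<open>
  Sending \<open>\<tau>\<^sub>a \<mapsto> \<tau>\<^sub>a\<close>, \<open>\<tau>\<^sub>b \<mapsto> \<tau>\<^sub>b\<close> and \<open>T \<mapsto> T\<^sup>2\<close> respects the defining relations, so it gives a
  homomorphism from the extension with \<open>(\<tau>\<^sub>a \<tau>\<^sub>b)\<^sup>6 = T\<close> to the one with \<open>(\<tau>\<^sub>a \<tau>\<^sub>b)\<^sup>6 = T\<^sup>2\<close>.  It
  lies over the identity of \<open>\<Gamma>\<^sub>1\<close> and doubles on the central kernels.  Composing a section of the
  first extension with it yields a section of the second whose factor set is twice the original
  one (\<open>extension_class_power\<close>), and this is the asserted equality of classes.  The same argument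
  shows that the class for \<open>(\<tau>\<^sub>a \<tau>\<^sub>b)\<^sup>6 = T\<^sup>m\<close> is \<open>m\<close> times the class for
  \<open>(\<tau>\<^sub>a \<tau>\<^sub>b)\<^sup>6 = T\<close>, with \<open>T\<^sup>l = 1\<close> in both groups (\<open>ext_class_power\<close>).

  What needs care is that the presentations really define central extensions by \<open>\<int>/l\<close>, that is,
  that \<open>T\<close> has order exactly \<open>l\<close> and generates the kernel of the projection to \<open>\<Gamma>\<^sub>1\<close>.  The order
  is detected by a degree: both sides of every relation have the same total weight modulo
  \<open>12 l\<close> if \<open>\<tau>\<^sub>a\<close> and \<open>\<tau>\<^sub>b\<close> weigh \<open>m\<close> and \<open>T\<close> weighs \<open>12\<close>, and \<open>12\<close> has order \<open>l\<close> in
  \<open>\<int>/12l\<close> (\<open>ext_incl_inj\<close>).  The kernel is found by inverting the projection modulo \<open>T\<close>: the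
  relations of \<open>\<Gamma>\<^sub>1\<close> hold in the quotient by \<open>\<langle>T\<rangle>\<close> (\<open>ext_proj_kernel\<close>).
\<close>

section \<open>Presented groups and their universal property\<close>

lemma word_class_eq_iff: "word_class Rel u = word_class Rel w \<longleftrightarrow> word_eq Rel u w"
proof
  assume "word_class Rel u = word_class Rel w"
  then have "w \<in> word_class Rel u"
    by (simp add: word_class_def word_eq.refl)
  then show "word_eq Rel u w"
    by (simp add: word_class_def)
next
  assume "word_eq Rel u w"
  then have "word_eq Rel u z \<longleftrightarrow> word_eq Rel w z" for z
    by (metis word_eq.sym word_eq.trans)
  then show "word_class Rel u = word_class Rel w"
    by (simp add: word_class_def)
qed

lemma carrier_presented_group [simp]: "carrier (presented_group Rel) = range (word_class Rel)"
  by (simp add: presented_group_def)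

lemma one_presented_group [simp]: "\<one>\<^bsub>presented_group Rel\<^esub> = word_class Rel []"
  by (simp add: presented_group_def)

lemma mult_word_class [simp]:
  "word_class Rel u \<otimes>\<^bsub>presented_group Rel\<^esub> word_class Rel w = word_class Rel (u @ w)"
proof -
  have "word_class Rel (u' @ w') = word_class Rel (u @ w)"
    if "u' \<in> word_class Rel u" "w' \<in> word_class Rel w" for u' w'
  proof -
    have "word_eq Rel (u @ w) (u' @ w')"
      using that by (intro word_eq.append) (simp_all add: word_class_def)
    then show ?thesis
      by (metis word_class_eq_iff)
  qed
  moreover have "u \<in> word_class Rel u" "w \<in> word_class Rel w"
    by (simp_all add: word_class_def word_eq.refl)
  ultimately have "(\<Union>u'\<in>word_class Rel u. \<Union>w'\<in>word_class Rel w. word_class Rel (u' @ w'))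
      = word_class Rel (u @ w)"
    by blast
  then show ?thesis
    by (simp add: presented_group_def)
qed

lemma word_eq_inverse: "word_eq Rel (map (apsnd Not) (rev u) @ u) []"
proof (induction u)
  case Nil
  show ?case by (simp add: word_eq.refl)
next
  case (Cons l u)
  obtain x e where l: "l = (x, e)" by force
  have "word_eq Rel ([(x, \<not> e), (x, \<not> \<not> e)] @ u) ([] @ u)"
    by (intro word_eq.append word_eq.cancel word_eq.refl)
  then have "word_eq Rel (map (apsnd Not) (rev u) @ [(x, \<not> e), (x, e)] @ u)
                         (map (apsnd Not) (rev u) @ u)"
    by (intro word_eq.append word_eq.refl) simp
  from word_eq.trans[OF this Cons.IH] show ?case
    by (simp add: l)
qed

lemma group_presented_group [simp]: "group (presented_group Rel)"
proof (rule groupI)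
  fix X assume "X \<in> carrier (presented_group Rel)"
  then obtain u where "X = word_class Rel u" by auto
  then have "word_class Rel (map (apsnd Not) (rev u)) \<otimes>\<^bsub>presented_group Rel\<^esub> X
      = \<one>\<^bsub>presented_group Rel\<^esub>"
    by (simp add: word_class_eq_iff word_eq_inverse)
  then show "\<exists>Y\<in>carrier (presented_group Rel).
      Y \<otimes>\<^bsub>presented_group Rel\<^esub> X = \<one>\<^bsub>presented_group Rel\<^esub>"
    by auto
next
  show "\<one>\<^bsub>presented_group Rel\<^esub> \<in> carrier (presented_group Rel)" by simp
qed (clarsimp; fail)+

lemma generator_closed [simp]: "generator Rel x \<in> carrier (presented_group Rel)"
  by (simp add: generator_def)

lemma word_eval_Nil [simp]: "word_eval G f [] = \<one>\<^bsub>G\<^esub>"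
  and word_eval_Cons [simp]: "word_eval G f ((x, e) # u) =
    (if e then f x else inv\<^bsub>G\<^esub> (f x)) \<otimes>\<^bsub>G\<^esub> word_eval G f u"
  by (simp_all add: word_eval_def)

context group
begin

lemma word_eval_closed [simp]:
  assumes "\<And>x. f x \<in> carrier G"
  shows "word_eval G f u \<in> carrier G"
  using assms by (induction u) auto

lemma word_eval_append:
  assumes "\<And>x. f x \<in> carrier G"
  shows "word_eval G f (u @ w) = word_eval G f u \<otimes> word_eval G f w"
  using assms by (induction u) (auto simp: m_assoc)

lemma word_eval_concat_replicate:
  assumes "\<And>x. f x \<in> carrier G"
  shows "word_eval G f (concat (replicate n u)) = word_eval G f u [^] n"
  using assms
  by (induction n) (simp_all add: word_eval_append group_commutes_pow)

lemma word_eval_replicate_pos: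
  assumes "\<And>x. f x \<in> carrier G"
  shows "word_eval G f (replicate n (pos x)) = f x [^] n"
  using assms by (induction n) (simp_all add: group_commutes_pow)

lemma inv_commute:
  assumes "x \<in> carrier G" "y \<in> carrier G" "x \<otimes> y = y \<otimes> x"
  shows "inv x \<otimes> y = y \<otimes> inv x"
proof -
  have "inv x \<otimes> y = inv x \<otimes> (y \<otimes> x) \<otimes> inv x"
    using assms(1,2) by (simp add: m_assoc)
  also have "\<dots> = y \<otimes> inv x"
    using assms(1,2) by (simp add: assms(3)[symmetric] m_assoc[symmetric])
  finally show ?thesis .
qed

text \<open>
  Applied with \<open>f\<close> the generators of a presented group, this reduces centrality to commuting with
  the generators.
\<close>

lemma word_eval_commute:
  assumes "\<And>x. f x \<in> carrier G" "t \<in> carrier G" and t: "\<And>x. t \<otimes> f x = f x \<otimes> t"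
  shows "t \<otimes> word_eval G f u = word_eval G f u \<otimes> t"
proof (induction u)
  case Nil
  show ?case using assms by simp
next
  case (Cons l u)
  obtain x e where l: "l = (x, e)" by force
  have "t \<otimes> inv (f x) = inv (f x) \<otimes> t"
    using assms by (intro inv_commute[symmetric]) simp_all
  with t have "t \<otimes> (if e then f x else inv (f x)) = (if e then f x else inv (f x)) \<otimes> t"
    by simp
  then have "t \<otimes> word_eval G f (l # u)
      = (if e then f x else inv (f x)) \<otimes> (t \<otimes> word_eval G f u)"
    using assms(1,2) by (simp add: l m_assoc[symmetric])
  with Cons.IH assms(1,2) show ?case
    by (simp add: l m_assoc)
qed

lemma word_eval_word_eq:
  assumes f: "\<And>x. f x \<in> carrier G"
    and rels: "\<forall>(u, w)\<in>Rel. word_eval G f u = word_eval G f w"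
    and "word_eq Rel u w"
  shows "word_eval G f u = word_eval G f w"
  using assms(3)
proof induction
  case (rel u w)
  then show ?case using rels by blast
next
  case (cancel x e)
  then show ?case using f by (cases e) simp_all
qed (simp_all add: f word_eval_append)

text \<open>
  The set of values that \<open>presented_hom\<close> collects is a singleton, because evaluation is constant on
  the classes of \<open>word_eq\<close> as soon as the defining relations hold in the target.
\<close>

lemma presented_hom_word_class:
  assumes f: "\<And>x. f x \<in> carrier G"
    and rels: "\<forall>(u, w)\<in>Rel. word_eval G f u = word_eval G f w"
  shows "presented_hom G f (word_class Rel u) = word_eval G f u"
proof -
  have "word_eval G f ` word_class Rel u = {word_eval G f u}"
    using word_eval_word_eq[OF assms] by (auto simp: word_class_def intro: word_eq.refl)
  then show ?thesis
    by (simp add: presented_hom_def)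
qed

lemma presented_hom_in_hom:
  assumes f: "\<And>x. f x \<in> carrier G"
    and rels: "\<forall>(u, w)\<in>Rel. word_eval G f u = word_eval G f w"
  shows "presented_hom G f \<in> hom (presented_group Rel) G"
  by (rule homI) (auto simp: presented_hom_word_class[OF assms] f word_eval_append)

lemma presented_hom_generator:
  assumes f: "\<And>x. f x \<in> carrier G"
    and rels: "\<forall>(u, w)\<in>Rel. word_eval G f u = word_eval G f w"
  shows "presented_hom G f (generator Rel x) = f x"
  by (simp add: generator_def presented_hom_word_class[OF assms] f)

end

lemma (in group_hom) hom_word_eval:
  assumes "\<And>x. f x \<in> carrier G"
  shows "h (word_eval G f u) = word_eval H (\<lambda>x. h (f x)) u"
  using assms by (induction u) auto

text \<open>
  Every element of a presented group is thus a value of \<open>word_eval\<close> at the generators, which is how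
  statements about evaluation are transferred to the presented group itself.
\<close>

lemma word_eval_generator: "word_eval (presented_group Rel) (generator Rel) u = word_class Rel u"
proof (induction u)
  case Nil
  show ?case by simp
next
  case (Cons l u)
  interpret P: group "presented_group Rel" by simp
  obtain x e where l: "l = (x, e)" by force
  have "inv\<^bsub>presented_group Rel\<^esub> (generator Rel x) = word_class Rel [(x, False)]"
    using word_eq.cancel[of Rel x False]
    by (intro P.inv_equality) (auto simp: generator_def word_class_eq_iff)
  with Cons.IH show ?case
    by (cases e) (simp_all add: l generator_def)
qed

lemma generator_relations:
  "\<forall>(u, w)\<in>Rel. word_eval (presented_group Rel) (generator Rel) u
     = word_eval (presented_group Rel) (generator Rel) w"
  by (auto simp: word_eval_generator word_class_eq_iff intro: word_eq.rel)

lemma presented_group_hom_eqI: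
  assumes h: "h \<in> hom (presented_group Rel) G" and k: "k \<in> hom (presented_group Rel) G"
    and G: "group G"
    and gens: "\<And>x. h (generator Rel x) = k (generator Rel x)"
    and X: "X \<in> carrier (presented_group Rel)"
  shows "h X = k X"
proof -
  interpret h: group_hom "presented_group Rel" G h
    by (simp add: G h group_hom.intro group_hom_axioms.intro)
  interpret k: group_hom "presented_group Rel" G k
    by (simp add: G k group_hom.intro group_hom_axioms.intro)
  obtain u where "X = word_eval (presented_group Rel) (generator Rel) u"
    using X by (auto simp: word_eval_generator)
  then show ?thesis
    by (simp only: h.hom_word_eval k.hom_word_eval generator_closed gens)
qed

section \<open>The torus mapping class group and its central extensions\<close>

lemma group_\<Gamma>1 [simp]: "group \<Gamma>1"
  by (simp add: \<Gamma>1_def)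

lemma group_ext_group [simp]: "group (ext_group m l)"
  by (simp add: ext_group_def)

lemma torus_generator_closed [simp]: "generator \<Gamma>1_rels x \<in> carrier \<Gamma>1"
  unfolding \<Gamma>1_def by (rule generator_closed)

lemma ext_generator_closed [simp]: "generator (ext_rels m l) x \<in> carrier (ext_group m l)"
  unfolding ext_group_def by (rule generator_closed)

text \<open>
  The next two lemmas turn the relations, given as pairs of words, into equations in an arbitrary
  target group.  They are used both to construct homomorphisms out of the presented groups and to
  read off the equations satisfied by the generators.
\<close>

lemma (in group) torus_relations_iff:
  assumes f: "\<And>x. f x \<in> carrier G"
  shows "(\<forall>(u, w)\<in>\<Gamma>1_rels. word_eval G f u = word_eval G f w) \<longleftrightarrow>
    f Tau_a \<otimes> (f Tau_b \<otimes> f Tau_a) = f Tau_b \<otimes> (f Tau_a \<otimes> f Tau_b) \<and>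
    (f Tau_a \<otimes> f Tau_b) [^] (6::nat) = \<one>"
  unfolding \<Gamma>1_rels_def ball_simps split_conv
  by (simp add: word_eval_concat_replicate[OF f] f del: concat_replicate_trivial)

lemma (in group) ext_relations_iff:
  assumes f: "\<And>x. f x \<in> carrier G"
  shows "(\<forall>(u, w)\<in>ext_rels m l. word_eval G f u = word_eval G f w) \<longleftrightarrow>
    f Ext_a \<otimes> (f Ext_b \<otimes> f Ext_a) = f Ext_b \<otimes> (f Ext_a \<otimes> f Ext_b) \<and>
    (f Ext_a \<otimes> f Ext_b) [^] (6::nat) = f Ext_T [^] m \<and> f Ext_T [^] l = \<one> \<and>
    f Ext_T \<otimes> f Ext_a = f Ext_a \<otimes> f Ext_T \<and> f Ext_T \<otimes> f Ext_b = f Ext_b \<otimes> f Ext_T"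
  unfolding ext_rels_def ball_simps split_conv
  by (simp add: word_eval_concat_replicate[OF f] word_eval_replicate_pos[OF f] f
        del: concat_replicate_trivial)

lemma torus_generator_relations:
  "generator \<Gamma>1_rels Tau_a \<otimes>\<^bsub>\<Gamma>1\<^esub> (generator \<Gamma>1_rels Tau_b \<otimes>\<^bsub>\<Gamma>1\<^esub> generator \<Gamma>1_rels Tau_a)
   = generator \<Gamma>1_rels Tau_b \<otimes>\<^bsub>\<Gamma>1\<^esub> (generator \<Gamma>1_rels Tau_a \<otimes>\<^bsub>\<Gamma>1\<^esub> generator \<Gamma>1_rels Tau_b)"
  "(generator \<Gamma>1_rels Tau_a \<otimes>\<^bsub>\<Gamma>1\<^esub> generator \<Gamma>1_rels Tau_b) [^]\<^bsub>\<Gamma>1\<^esub> (6::nat) = \<one>\<^bsub>\<Gamma>1\<^esub>"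
  using generator_relations[of \<Gamma>1_rels, folded \<Gamma>1_def]
  unfolding group.torus_relations_iff[OF group_\<Gamma>1 torus_generator_closed] by blast+

lemma ext_generator_relations:
  fixes m l
  defines "a \<equiv> generator (ext_rels m l) Ext_a" and "b \<equiv> generator (ext_rels m l) Ext_b"
    and "T \<equiv> generator (ext_rels m l) Ext_T"
  shows "a \<otimes>\<^bsub>ext_group m l\<^esub> (b \<otimes>\<^bsub>ext_group m l\<^esub> a) = b \<otimes>\<^bsub>ext_group m l\<^esub> (a \<otimes>\<^bsub>ext_group m l\<^esub> b)"
    "(a \<otimes>\<^bsub>ext_group m l\<^esub> b) [^]\<^bsub>ext_group m l\<^esub> (6::nat) = T [^]\<^bsub>ext_group m l\<^esub> m"
    "T [^]\<^bsub>ext_group m l\<^esub> l = \<one>\<^bsub>ext_group m l\<^esub>"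
    "T \<otimes>\<^bsub>ext_group m l\<^esub> a = a \<otimes>\<^bsub>ext_group m l\<^esub> T"
    "T \<otimes>\<^bsub>ext_group m l\<^esub> b = b \<otimes>\<^bsub>ext_group m l\<^esub> T"
  using generator_relations[of "ext_rels m l", folded ext_group_def]
  unfolding group.ext_relations_iff[OF group_ext_group ext_generator_closed] a_def b_def T_def
  by blast+

lemma ext_T_commute:
  assumes "X \<in> carrier (ext_group m l)"
  shows "generator (ext_rels m l) Ext_T \<otimes>\<^bsub>ext_group m l\<^esub> X
       = X \<otimes>\<^bsub>ext_group m l\<^esub> generator (ext_rels m l) Ext_T"
proof -
  interpret E: group "ext_group m l" by simp
  obtain u where X: "X = word_eval (ext_group m l) (generator (ext_rels m l)) u"
    using assms by (auto simp: word_eval_generator ext_group_def)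
  have "generator (ext_rels m l) Ext_T \<otimes>\<^bsub>ext_group m l\<^esub> generator (ext_rels m l) x
       = generator (ext_rels m l) x \<otimes>\<^bsub>ext_group m l\<^esub> generator (ext_rels m l) Ext_T" for x
    by (cases x) (simp_all add: ext_generator_relations(4,5))
  then show ?thesis
    unfolding X by (intro E.word_eval_commute) simp_all
qed

lemma ext_incl_central:
  assumes X: "X \<in> carrier (ext_group m l)"
  shows "ext_incl m l k \<otimes>\<^bsub>ext_group m l\<^esub> X = X \<otimes>\<^bsub>ext_group m l\<^esub> ext_incl m l k"
proof -
  interpret E: group "ext_group m l" by simp
  have pow: "generator (ext_rels m l) Ext_T [^]\<^bsub>ext_group m l\<^esub> n \<otimes>\<^bsub>ext_group m l\<^esub> X
      = X \<otimes>\<^bsub>ext_group m l\<^esub> generator (ext_rels m l) Ext_T [^]\<^bsub>ext_group m l\<^esub> n" for n :: nat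
    using X by (intro E.group_commutes_pow ext_T_commute) simp_all
  show ?thesis
  proof (cases k rule: int_cases2)
    case (nonneg n)
    with pow show ?thesis by (simp add: ext_incl_def int_pow_int)
  next
    case (nonpos n)
    with E.inv_commute[OF _ X pow] show ?thesis
      by (simp add: ext_incl_def E.int_pow_neg_int)
  qed
qed

lemma ext_incl_closed [simp]: "ext_incl m l k \<in> carrier (ext_group m l)"
proof -
  interpret E: group "ext_group m l" by simp
  show ?thesis by (simp add: ext_incl_def)
qed

lemma ext_incl_add: "ext_incl m l (j + k) = ext_incl m l j \<otimes>\<^bsub>ext_group m l\<^esub> ext_incl m l k"
  by (simp add: ext_incl_def group.int_pow_mult)

text \<open>
  This is the relation \<open>T\<^sup>l = 1\<close>, in the form that makes \<open>k \<mapsto> T\<^sup>k\<close> a homomorphism on residues;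
  for \<open>l = 0\<close> it is void, since then \<open>k mod 0 = k\<close>.
\<close>

lemma ext_incl_mod: "ext_incl m l (k mod int l) = ext_incl m l k"
proof -
  interpret E: group "ext_group m l" by simp
  have "ext_incl m l (int l * q) = \<one>\<^bsub>ext_group m l\<^esub>" for q
    by (simp add: ext_incl_def E.int_pow_pow[symmetric] int_pow_int ext_generator_relations(3))
  then show ?thesis
    using ext_incl_add[of m l "int l * (k div int l)" "k mod int l"] by simp
qed

lemma ext_incl_hom: "ext_incl m l \<in> hom (integer_mod_group l) (ext_group m l)"
  by (rule homI) (simp_all add: ext_incl_mod ext_incl_add)

lemma ext_incl_image: "ext_incl m l ` carrier (integer_mod_group l) = range (ext_incl m l)"
proof -
  have "k mod int l \<in> carrier (integer_mod_group l)" for k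
    by (simp add: carrier_integer_mod_group)
  then show ?thesis
    by (metis ext_incl_mod image_eqI image_subsetI subset_antisym top_greatest image_mono rangeI)
qed

text \<open>
  The weights modulo \<open>12 l\<close>: the word \<open>(\<tau>\<^sub>a \<tau>\<^sub>b)\<^sup>6\<close> has twelve letters, so with letters of weight
  \<open>m\<close> it weighs as much as \<open>T\<^sup>m\<close> when \<open>T\<close> weighs \<open>12\<close>.
\<close>

definition ext_degree :: "nat \<Rightarrow> nat \<Rightarrow> ext_gen \<Rightarrow> int" where
  "ext_degree m l x = (case x of Ext_T \<Rightarrow> 12 | _ \<Rightarrow> int m) mod int (12 * l)"

text \<open>
  The homomorphism to \<open>\<int>/12l\<close> given by the weights maps \<open>T\<^sup>k\<close> to \<open>12 k\<close>, which determines \<open>k\<close>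
  modulo \<open>l\<close>.  For \<open>l = 0\<close> the target is \<open>\<int>\<close> and \<open>T\<close> has infinite order.
\<close>

lemma ext_incl_inj: "inj_on (ext_incl m l) (carrier (integer_mod_group l))"
proof (rule inj_onI)
  fix j k
  assume jk: "j \<in> carrier (integer_mod_group l)" "k \<in> carrier (integer_mod_group l)"
    and eq: "ext_incl m l j = ext_incl m l k"
  let ?Z = "integer_mod_group (12 * l)"
  interpret Z: group ?Z by simp
  have d: "ext_degree m l x \<in> carrier ?Z" for x
    by (simp add: ext_degree_def carrier_integer_mod_group)
  have rels: "\<forall>(u, w)\<in>ext_rels m l. word_eval ?Z (ext_degree m l) u = word_eval ?Z (ext_degree m l) w"
    unfolding Z.ext_relations_iff[of "ext_degree m l", OF d]
    by (simp add: ext_degree_def mod_simps algebra_simps)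
  interpret d: group_hom "ext_group m l" ?Z "presented_hom ?Z (ext_degree m l)"
    by (simp add: group_hom.intro group_hom_axioms.intro ext_group_def
        Z.presented_hom_in_hom[OF d rels])
  have "presented_hom ?Z (ext_degree m l) (ext_incl m l i)
      = (i * ext_degree m l Ext_T) mod int (12 * l)" for i
    by (simp add: ext_incl_def d.hom_int_pow int_pow_integer_mod_group
        Z.presented_hom_generator[OF d rels])
  then have "presented_hom ?Z (ext_degree m l) (ext_incl m l i) = (12 * i) mod int (12 * l)" for i
    by (simp add: ext_degree_def mod_simps mult.commute[of i])
  with eq have "12 * (j mod int l) = 12 * (k mod int l)"
    by (metis mult_mod_right of_nat_mult of_nat_numeral)
  with jk show "j = k"
    by (auto simp: carrier_integer_mod_group split: if_splits)
qed

abbreviation proj_generator :: "ext_gen \<Rightarrow> torus_gen word set" where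
  "proj_generator \<equiv> \<lambda>x. case x of Ext_a \<Rightarrow> generator \<Gamma>1_rels Tau_a
                 | Ext_b \<Rightarrow> generator \<Gamma>1_rels Tau_b
                 | Ext_T \<Rightarrow> \<one>\<^bsub>\<Gamma>1\<^esub>"

lemma proj_generator_closed: "proj_generator x \<in> carrier \<Gamma>1"
proof -
  interpret \<Gamma>: group \<Gamma>1 by simp
  show ?thesis by (cases x) simp_all
qed

lemma proj_generator_relations:
  "\<forall>(u, w)\<in>ext_rels m l. word_eval \<Gamma>1 proj_generator u = word_eval \<Gamma>1 proj_generator w"
proof -
  interpret \<Gamma>: group \<Gamma>1 by simp
  show ?thesis
    unfolding \<Gamma>.ext_relations_iff[of proj_generator, OF proj_generator_closed]
    by (simp add: torus_generator_relations)
qed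

lemma ext_proj_hom: "ext_proj \<in> hom (ext_group m l) \<Gamma>1"
  unfolding ext_proj_def ext_group_def
  by (rule group.presented_hom_in_hom[OF group_\<Gamma>1 proj_generator_closed proj_generator_relations])

lemma ext_proj_generator: "ext_proj (generator (ext_rels m l) x) = proj_generator x"
  unfolding ext_proj_def ext_group_def
  by (rule group.presented_hom_generator[OF group_\<Gamma>1 proj_generator_closed
        proj_generator_relations])

lemma ext_proj_surj: "ext_proj ` carrier (ext_group m l) = carrier \<Gamma>1"
proof
  interpret p: group_hom "ext_group m l" \<Gamma>1 ext_proj
    by (simp add: group_hom.intro group_hom_axioms.intro ext_proj_hom)
  show "ext_proj ` carrier (ext_group m l) \<subseteq> carrier \<Gamma>1"
    by auto
  let ?f = "\<lambda>x. generator (ext_rels m l) (case x of Tau_a \<Rightarrow> Ext_a | Tau_b \<Rightarrow> Ext_b)"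
  have *: "(\<lambda>x. ext_proj (?f x)) = generator \<Gamma>1_rels"
    by (auto simp: fun_eq_iff ext_proj_generator split: torus_gen.split)
  have proj: "ext_proj (word_eval (ext_group m l) ?f u) = word_class \<Gamma>1_rels u" for u
    by (simp add: p.hom_word_eval * \<Gamma>1_def word_eval_generator)
  show "carrier \<Gamma>1 \<subseteq> ext_proj ` carrier (ext_group m l)"
  proof
    fix X assume "X \<in> carrier \<Gamma>1"
    then obtain u where "X = word_class \<Gamma>1_rels u"
      by (auto simp: \<Gamma>1_def)
    then show "X \<in> ext_proj ` carrier (ext_group m l)"
      by (intro image_eqI[where x = "word_eval (ext_group m l) ?f u"]) (simp_all add: proj)
  qed
qed

text \<open>
  The quotient by \<open>N = \<langle>T\<rangle>\<close> satisfies the relations of \<open>\<Gamma>\<^sub>1\<close>, because \<open>(\<tau>\<^sub>a \<tau>\<^sub>b)\<^sup>6 = T\<^sup>m\<close>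
  becomes trivial there.  The resulting homomorphism \<open>g\<close> from \<open>\<Gamma>\<^sub>1\<close> to the quotient satisfies
  \<open>g (p X) = N X\<close>, since both sides agree on generators; so \<open>p X = 1\<close> forces \<open>X \<in> N\<close>.
\<close>

lemma ext_proj_kernel: "kernel (ext_group m l) \<Gamma>1 ext_proj = range (ext_incl m l)"
proof
  let ?E = "ext_group m l" and ?N = "range (ext_incl m l)"
  interpret E: group ?E by simp
  interpret p: group_hom ?E \<Gamma>1 ext_proj
    by (simp add: group_hom.intro group_hom_axioms.intro ext_proj_hom)
  have "ext_proj (ext_incl m l k) = \<one>\<^bsub>\<Gamma>1\<^esub>" for k
    by (simp add: ext_incl_def p.hom_int_pow ext_proj_generator)
  then show "?N \<subseteq> kernel ?E \<Gamma>1 ext_proj"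
    by (auto simp: kernel_def)
  interpret i: group_hom "integer_mod_group l" ?E "ext_incl m l"
    by (simp add: group_hom.intro group_hom_axioms.intro ext_incl_hom)
  have sub: "subgroup ?N ?E"
    using i.img_is_subgroup by (simp add: ext_incl_image)
  have "X \<otimes>\<^bsub>?E\<^esub> ext_incl m l k \<otimes>\<^bsub>?E\<^esub> inv\<^bsub>?E\<^esub> X = ext_incl m l k" if "X \<in> carrier ?E" for X k
    using that by (simp add: ext_incl_central[OF that, symmetric] E.m_assoc)
  then interpret N: normal ?N ?E
    using sub by (intro E.normal_invI) auto
  interpret Q: group "?E Mod ?N" by (rule N.factorgroup_is_group)
  interpret q: group_hom ?E "?E Mod ?N" "\<lambda>x. ?N #>\<^bsub>?E\<^esub> x"
    by (simp add: group_hom.intro group_hom_axioms.intro N.r_coset_hom_Mod Q.group_axioms)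
  let ?a = "generator (ext_rels m l) Ext_a" and ?b = "generator (ext_rels m l) Ext_b"
    and ?T = "generator (ext_rels m l) Ext_T"
  define f where "f = (\<lambda>x. ?N #>\<^bsub>?E\<^esub> (case x of Tau_a \<Rightarrow> ?a | Tau_b \<Rightarrow> ?b))"
  have f: "f x \<in> carrier (?E Mod ?N)" for x
    by (cases x) (simp_all add: f_def del: mult_FactGroup)
  have "?T = ext_incl m l 1"
    by (simp add: ext_incl_def)
  then have T: "?N #>\<^bsub>?E\<^esub> ?T = \<one>\<^bsub>?E Mod ?N\<^esub>"
    by (simp add: E.coset_join2[OF _ sub])
  have "?N #>\<^bsub>?E\<^esub> (?a \<otimes>\<^bsub>?E\<^esub> (?b \<otimes>\<^bsub>?E\<^esub> ?a)) = ?N #>\<^bsub>?E\<^esub> (?b \<otimes>\<^bsub>?E\<^esub> (?a \<otimes>\<^bsub>?E\<^esub> ?b))"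
    by (simp only: ext_generator_relations(1))
  moreover have "?N #>\<^bsub>?E\<^esub> ((?a \<otimes>\<^bsub>?E\<^esub> ?b) [^]\<^bsub>?E\<^esub> (6::nat)) = \<one>\<^bsub>?E Mod ?N\<^esub>"
    unfolding ext_generator_relations(2)
    by (simp add: q.hom_nat_pow T del: one_FactGroup)
  ultimately have rels: "\<forall>(u, w)\<in>\<Gamma>1_rels. word_eval (?E Mod ?N) f u = word_eval (?E Mod ?N) f w"
    unfolding Q.torus_relations_iff[of f, OF f] unfolding f_def
    by (simp add: q.hom_nat_pow del: mult_FactGroup one_FactGroup)
  define g where "g = presented_hom (?E Mod ?N) f"
  have g: "g \<in> hom \<Gamma>1 (?E Mod ?N)"
    unfolding g_def \<Gamma>1_def by (rule Q.presented_hom_in_hom[OF f rels])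
  then interpret g: group_hom \<Gamma>1 "?E Mod ?N" g
    by (simp add: group_hom.intro group_hom_axioms.intro Q.group_axioms)
  have gen: "g (generator \<Gamma>1_rels x) = f x" for x
    unfolding g_def by (rule Q.presented_hom_generator[OF f rels])
  have gp: "g (ext_proj X) = ?N #>\<^bsub>?E\<^esub> X" if "X \<in> carrier ?E" for X
  proof -
    have "(g \<circ> ext_proj) X = ?N #>\<^bsub>?E\<^esub> X"
    proof (rule presented_group_hom_eqI[where Rel = "ext_rels m l", folded ext_group_def])
      show "(g \<circ> ext_proj) (generator (ext_rels m l) x) = ?N #>\<^bsub>?E\<^esub> generator (ext_rels m l) x"
        for x
        by (cases x) (simp_all add: ext_proj_generator gen T f_def del: one_FactGroup)
      show "g \<circ> ext_proj \<in> hom ?E (?E Mod ?N)"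
        using ext_proj_hom g by (rule hom_compose)
    qed (use that q.homh Q.group_axioms in simp_all)
    then show ?thesis by simp
  qed
  show "kernel ?E \<Gamma>1 ext_proj \<subseteq> ?N"
  proof
    fix X assume "X \<in> kernel ?E \<Gamma>1 ext_proj"
    then have X: "X \<in> carrier ?E" "ext_proj X = \<one>\<^bsub>\<Gamma>1\<^esub>"
      by (auto simp: kernel_def)
    with gp[of X] g.hom_one have "?N #>\<^bsub>?E\<^esub> X = ?N"
      by simp
    with E.rcos_self[OF X(1) sub] show "X \<in> ?N"
      by simp
  qed
qed

lemma central_extension_ext_group:
  "central_extension (integer_mod_group l) (ext_group m l) \<Gamma>1 (ext_incl m l) ext_proj"
  unfolding central_extension_def
  by (simp add: ext_incl_hom ext_incl_inj ext_proj_hom ext_proj_surj ext_proj_kernel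
      ext_incl_image ext_incl_central)

text \<open>
  The map \<open>T \<mapsto> T\<^sup>m\<close> turns the relation \<open>(\<tau>\<^sub>a \<tau>\<^sub>b)\<^sup>6 = T\<close> of the source into the relation
  \<open>(\<tau>\<^sub>a \<tau>\<^sub>b)\<^sup>6 = T\<^sup>m\<close> of the target.
\<close>

lemma ext_group_power_hom:
  obtains \<phi> where "\<phi> \<in> hom (ext_group 1 l) (ext_group m l)"
    "\<And>X. X \<in> carrier (ext_group 1 l) \<Longrightarrow> ext_proj (\<phi> X) = ext_proj X"
    "\<And>k. \<phi> (ext_incl 1 l k) = ext_incl m l (int m * k)"
proof -
  let ?E = "ext_group m l"
  let ?T = "generator (ext_rels m l) Ext_T"
  interpret E: group ?E by simp
  define f where "f = (\<lambda>x. if x = Ext_T then ?T [^]\<^bsub>?E\<^esub> m else generator (ext_rels m l) x)"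
  have f: "f x \<in> carrier ?E" for x
    by (simp add: f_def)
  have "(?T [^]\<^bsub>?E\<^esub> m) [^]\<^bsub>?E\<^esub> l = \<one>\<^bsub>?E\<^esub>"
    by (metis E.nat_pow_one E.nat_pow_pow ext_generator_closed ext_generator_relations(3)
        mult.commute)
  then have rels: "\<forall>(u, w)\<in>ext_rels 1 l. word_eval ?E f u = word_eval ?E f w"
    unfolding E.ext_relations_iff[of f, OF f]
    by (simp add: f_def ext_generator_relations E.group_commutes_pow)
  define \<phi> where "\<phi> = presented_hom ?E f"
  have hom: "\<phi> \<in> hom (ext_group 1 l) ?E"
    unfolding \<phi>_def ext_group_def[of 1] by (rule E.presented_hom_in_hom[OF f rels])
  have gen: "\<phi> (generator (ext_rels 1 l) x) = f x" for x
    unfolding \<phi>_def by (rule E.presented_hom_generator[OF f rels])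
  interpret p: group_hom ?E \<Gamma>1 ext_proj
    by (simp add: group_hom.intro group_hom_axioms.intro ext_proj_hom)
  show thesis
  proof
    show "\<phi> \<in> hom (ext_group 1 l) ?E" by (rule hom)
    show "ext_proj (\<phi> X) = ext_proj X" if "X \<in> carrier (ext_group 1 l)" for X
    proof -
      have "(ext_proj \<circ> \<phi>) X = ext_proj X"
      proof (rule presented_group_hom_eqI[where Rel = "ext_rels 1 l", folded ext_group_def])
        show "(ext_proj \<circ> \<phi>) (generator (ext_rels 1 l) x) = ext_proj (generator (ext_rels 1 l) x)"
          for x
          by (cases x) (simp_all add: gen f_def p.hom_nat_pow ext_proj_generator del: One_nat_def)
        show "ext_proj \<circ> \<phi> \<in> hom (ext_group 1 l) \<Gamma>1"
          using hom ext_proj_hom by (rule hom_compose)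
      qed (use that ext_proj_hom in simp_all)
      then show ?thesis by simp
    qed
    interpret \<phi>: group_hom "ext_group 1 l" ?E \<phi>
      by (simp add: group_hom.intro group_hom_axioms.intro hom del: One_nat_def)
    show "\<phi> (ext_incl 1 l k) = ext_incl m l (int m * k)" for k
      by (simp add: ext_incl_def \<phi>.hom_int_pow gen f_def E.int_pow_pow del: One_nat_def flip: int_pow_int)
  qed
qed

section \<open>Second cohomology and classes of central extensions\<close>

locale trivial_coefficients = G: group G + A: comm_group A
  for G :: "('g, 'm) monoid_scheme" and A :: "'a monoid"
begin

lemma carrier_cochain2: "carrier (cochain2_group G A) = (\<Pi>\<^sub>E x\<in>carrier G \<times> carrier G. carrier A)"
  by (simp add: cochain2_group_def)

lemma mult_cochain2: "f \<otimes>\<^bsub>cochain2_group G A\<^esub> f' = (\<lambda>x\<in>carrier G \<times> carrier G. f x \<otimes>\<^bsub>A\<^esub> f' x)"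
  by (simp add: cochain2_group_def)

lemma cocycles2_iff:
  "f \<in> cocycles2 G A \<longleftrightarrow> f \<in> carrier (cochain2_group G A) \<and>
    (\<forall>g\<in>carrier G. \<forall>h\<in>carrier G. \<forall>k\<in>carrier G.
      f (h, k) \<otimes>\<^bsub>A\<^esub> f (g, h \<otimes>\<^bsub>G\<^esub> k) = f (g \<otimes>\<^bsub>G\<^esub> h, k) \<otimes>\<^bsub>A\<^esub> f (g, h))"
  by (simp add: cocycles2_def)

lemma cochain2_closed:
  assumes "f \<in> carrier (cochain2_group G A)" "g \<in> carrier G" "h \<in> carrier G"
  shows "f (g, h) \<in> carrier A"
  using assms by (auto simp: carrier_cochain2)

lemma comm_group_cochain2: "comm_group (cochain2_group G A)"
proof -
  have "group (cochain2_group G A)"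
    unfolding cochain2_group_def by (rule product_group) (rule A.group_axioms)
  then show ?thesis
    by (rule group.group_comm_groupI)
      (auto simp: mult_cochain2 carrier_cochain2 fun_eq_iff restrict_def intro!: A.m_comm)
qed

lemma inv_cochain2:
  assumes "f \<in> carrier (cochain2_group G A)"
  shows "inv\<^bsub>cochain2_group G A\<^esub> f = (\<lambda>x\<in>carrier G \<times> carrier G. inv\<^bsub>A\<^esub> (f x))"
  using assms unfolding cochain2_group_def by (intro inv_product_group) simp_all

lemma pow_cochain2:
  assumes "f \<in> carrier (cochain2_group G A)"
  shows "f [^]\<^bsub>cochain2_group G A\<^esub> (n::nat) = (\<lambda>x\<in>carrier G \<times> carrier G. f x [^]\<^bsub>A\<^esub> n)"
proof (induction n)
  case 0
  show ?case by (simp add: cochain2_group_def)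
next
  case (Suc n)
  then show ?case by (simp add: mult_cochain2 fun_eq_iff)
qed

lemma subgroup_cocycles2: "subgroup (cocycles2 G A) (cochain2_group G A)"
proof -
  interpret C: comm_group "cochain2_group G A" by (rule comm_group_cochain2)
  show ?thesis
  proof (rule C.subgroupI)
    show "cocycles2 G A \<subseteq> carrier (cochain2_group G A)"
      by (auto simp: cocycles2_iff)
    have "\<one>\<^bsub>cochain2_group G A\<^esub> \<in> cocycles2 G A"
      by (auto simp: cocycles2_iff) (simp add: cochain2_group_def)
    then show "cocycles2 G A \<noteq> {}" by blast
  next
    fix f assume f: "f \<in> cocycles2 G A"
    then have C: "f \<in> carrier (cochain2_group G A)" by (simp add: cocycles2_iff)
    note closed = cochain2_closed[OF C]
    show "inv\<^bsub>cochain2_group G A\<^esub> f \<in> cocycles2 G A"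
      unfolding cocycles2_iff
    proof (intro conjI ballI)
      fix g h k assume "g \<in> carrier G" "h \<in> carrier G" "k \<in> carrier G"
      with f show "(inv\<^bsub>cochain2_group G A\<^esub> f) (h, k) \<otimes>\<^bsub>A\<^esub> (inv\<^bsub>cochain2_group G A\<^esub> f) (g, h \<otimes>\<^bsub>G\<^esub> k)
        = (inv\<^bsub>cochain2_group G A\<^esub> f) (g \<otimes>\<^bsub>G\<^esub> h, k) \<otimes>\<^bsub>A\<^esub> (inv\<^bsub>cochain2_group G A\<^esub> f) (g, h)"
        by (simp add: inv_cochain2[OF C] closed cocycles2_iff flip: A.inv_mult)
    qed (use C in simp)
  next
    fix f f' assume f: "f \<in> cocycles2 G A" and f': "f' \<in> cocycles2 G A"
    then have C: "f \<in> carrier (cochain2_group G A)" "f' \<in> carrier (cochain2_group G A)"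
      by (simp_all add: cocycles2_iff)
    note closed = cochain2_closed[OF C(1)] cochain2_closed[OF C(2)]
    show "f \<otimes>\<^bsub>cochain2_group G A\<^esub> f' \<in> cocycles2 G A"
      unfolding cocycles2_iff
    proof (intro conjI ballI)
      fix g h k assume ghk: "g \<in> carrier G" "h \<in> carrier G" "k \<in> carrier G"
      have "(f (h, k) \<otimes>\<^bsub>A\<^esub> f' (h, k)) \<otimes>\<^bsub>A\<^esub> (f (g, h \<otimes>\<^bsub>G\<^esub> k) \<otimes>\<^bsub>A\<^esub> f' (g, h \<otimes>\<^bsub>G\<^esub> k))
          = (f (h, k) \<otimes>\<^bsub>A\<^esub> f (g, h \<otimes>\<^bsub>G\<^esub> k)) \<otimes>\<^bsub>A\<^esub> (f' (h, k) \<otimes>\<^bsub>A\<^esub> f' (g, h \<otimes>\<^bsub>G\<^esub> k))"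
        using ghk by (simp add: closed A.m_ac)
      also have "\<dots> = (f (g \<otimes>\<^bsub>G\<^esub> h, k) \<otimes>\<^bsub>A\<^esub> f (g, h)) \<otimes>\<^bsub>A\<^esub> (f' (g \<otimes>\<^bsub>G\<^esub> h, k) \<otimes>\<^bsub>A\<^esub> f' (g, h))"
        using f f' ghk by (simp add: cocycles2_iff)
      also have "\<dots> = (f (g \<otimes>\<^bsub>G\<^esub> h, k) \<otimes>\<^bsub>A\<^esub> f' (g \<otimes>\<^bsub>G\<^esub> h, k)) \<otimes>\<^bsub>A\<^esub> (f (g, h) \<otimes>\<^bsub>A\<^esub> f' (g, h))"
        using ghk by (simp add: closed A.m_ac)
      finally show "(f \<otimes>\<^bsub>cochain2_group G A\<^esub> f') (h, k) \<otimes>\<^bsub>A\<^esub> (f \<otimes>\<^bsub>cochain2_group G A\<^esub> f') (g, h \<otimes>\<^bsub>G\<^esub> k)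
        = (f \<otimes>\<^bsub>cochain2_group G A\<^esub> f') (g \<otimes>\<^bsub>G\<^esub> h, k) \<otimes>\<^bsub>A\<^esub> (f \<otimes>\<^bsub>cochain2_group G A\<^esub> f') (g, h)"
        using ghk by (simp add: mult_cochain2)
    qed (use C in \<open>rule C.m_closed\<close>)
  qed
qed

lemma coboundary1_apply [simp]:
  assumes "g \<in> carrier G" "h \<in> carrier G"
  shows "coboundary1 G A b (g, h) = b g \<otimes>\<^bsub>A\<^esub> b h \<otimes>\<^bsub>A\<^esub> inv\<^bsub>A\<^esub> (b (g \<otimes>\<^bsub>G\<^esub> h))"
  using assms by (simp add: coboundary1_def)

lemma coboundary1_closed:
  assumes "b \<in> carrier G \<rightarrow> carrier A"
  shows "coboundary1 G A b \<in> carrier (cochain2_group G A)"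
  using assms by (auto simp: carrier_cochain2 coboundary1_def Pi_iff)

text \<open>
  With \<open>p = b (g \<otimes> h)\<close> or \<open>p = b (h \<otimes> k)\<close>, both sides of the cocycle identity telescope to
  \<open>b g \<otimes> b h \<otimes> b k\<close> divided by \<open>b (g \<otimes> h \<otimes> k)\<close>; \<open>cancel\<close> below is that telescoping.
\<close>

lemma coboundary1_cocycle:
  assumes b: "b \<in> carrier G \<rightarrow> carrier A"
  shows "coboundary1 G A b \<in> cocycles2 G A"
  unfolding cocycles2_iff
proof (intro conjI ballI coboundary1_closed[OF b])
  fix g h k assume ghk: "g \<in> carrier G" "h \<in> carrier G" "k \<in> carrier G"
  have cl: "b x \<in> carrier A" if "x \<in> carrier G" for x
    using b that by auto
  have cancel: "(y \<otimes>\<^bsub>A\<^esub> z \<otimes>\<^bsub>A\<^esub> inv\<^bsub>A\<^esub> p) \<otimes>\<^bsub>A\<^esub> (x \<otimes>\<^bsub>A\<^esub> p \<otimes>\<^bsub>A\<^esub> inv\<^bsub>A\<^esub> q) = x \<otimes>\<^bsub>A\<^esub> y \<otimes>\<^bsub>A\<^esub> z \<otimes>\<^bsub>A\<^esub> inv\<^bsub>A\<^esub> q"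
    if [simp]: "x \<in> carrier A" "y \<in> carrier A" "z \<in> carrier A" "p \<in> carrier A" "q \<in> carrier A"
    for x y z p q
  proof -
    have "(y \<otimes>\<^bsub>A\<^esub> z \<otimes>\<^bsub>A\<^esub> inv\<^bsub>A\<^esub> p) \<otimes>\<^bsub>A\<^esub> (x \<otimes>\<^bsub>A\<^esub> p \<otimes>\<^bsub>A\<^esub> inv\<^bsub>A\<^esub> q)
        = (x \<otimes>\<^bsub>A\<^esub> y \<otimes>\<^bsub>A\<^esub> z \<otimes>\<^bsub>A\<^esub> inv\<^bsub>A\<^esub> q) \<otimes>\<^bsub>A\<^esub> (p \<otimes>\<^bsub>A\<^esub> inv\<^bsub>A\<^esub> p)"
      by (simp add: A.m_ac del: A.r_inv A.Units_r_inv)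
    then show ?thesis by simp
  qed
  have "coboundary1 G A b (h, k) \<otimes>\<^bsub>A\<^esub> coboundary1 G A b (g, h \<otimes>\<^bsub>G\<^esub> k)
      = b g \<otimes>\<^bsub>A\<^esub> b h \<otimes>\<^bsub>A\<^esub> b k \<otimes>\<^bsub>A\<^esub> inv\<^bsub>A\<^esub> (b (g \<otimes>\<^bsub>G\<^esub> h \<otimes>\<^bsub>G\<^esub> k))"
    using ghk by (simp add: cl cancel G.m_assoc)
  moreover have "coboundary1 G A b (g, h) \<otimes>\<^bsub>A\<^esub> coboundary1 G A b (g \<otimes>\<^bsub>G\<^esub> h, k)
      = (b g \<otimes>\<^bsub>A\<^esub> b h \<otimes>\<^bsub>A\<^esub> inv\<^bsub>A\<^esub> (b (g \<otimes>\<^bsub>G\<^esub> h)))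
        \<otimes>\<^bsub>A\<^esub> (b k \<otimes>\<^bsub>A\<^esub> b (g \<otimes>\<^bsub>G\<^esub> h) \<otimes>\<^bsub>A\<^esub> inv\<^bsub>A\<^esub> (b (g \<otimes>\<^bsub>G\<^esub> h \<otimes>\<^bsub>G\<^esub> k)))"
    using ghk by (simp add: cl A.m_comm)
  moreover have "\<dots> = b k \<otimes>\<^bsub>A\<^esub> b g \<otimes>\<^bsub>A\<^esub> b h \<otimes>\<^bsub>A\<^esub> inv\<^bsub>A\<^esub> (b (g \<otimes>\<^bsub>G\<^esub> h \<otimes>\<^bsub>G\<^esub> k))"
    using ghk by (intro cancel) (simp_all add: cl)
  moreover have "\<dots> = b g \<otimes>\<^bsub>A\<^esub> b h \<otimes>\<^bsub>A\<^esub> b k \<otimes>\<^bsub>A\<^esub> inv\<^bsub>A\<^esub> (b (g \<otimes>\<^bsub>G\<^esub> h \<otimes>\<^bsub>G\<^esub> k))"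
    using ghk by (simp add: cl A.m_ac)
  moreover have "coboundary1 G A b (g \<otimes>\<^bsub>G\<^esub> h, k) \<otimes>\<^bsub>A\<^esub> coboundary1 G A b (g, h)
      = coboundary1 G A b (g, h) \<otimes>\<^bsub>A\<^esub> coboundary1 G A b (g \<otimes>\<^bsub>G\<^esub> h, k)"
    using ghk by (intro A.m_comm cochain2_closed coboundary1_closed b) simp_all
  ultimately show "coboundary1 G A b (h, k) \<otimes>\<^bsub>A\<^esub> coboundary1 G A b (g, h \<otimes>\<^bsub>G\<^esub> k)
      = coboundary1 G A b (g \<otimes>\<^bsub>G\<^esub> h, k) \<otimes>\<^bsub>A\<^esub> coboundary1 G A b (g, h)"
    by presburger
qed

lemma coboundary1_mult:
  assumes b: "b \<in> carrier G \<rightarrow> carrier A" and b': "b' \<in> carrier G \<rightarrow> carrier A"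
  shows "coboundary1 G A b \<otimes>\<^bsub>cochain2_group G A\<^esub> coboundary1 G A b'
       = coboundary1 G A (\<lambda>g. b g \<otimes>\<^bsub>A\<^esub> b' g)"
proof -
  have cl: "b x \<in> carrier A" "b' x \<in> carrier A" if "x \<in> carrier G" for x
    using b b' that by auto
  show ?thesis
    unfolding mult_cochain2 coboundary1_def
    by (rule restrict_ext) (auto simp: cl A.m_ac A.inv_mult)
qed

lemma coboundary1_inv:
  assumes b: "b \<in> carrier G \<rightarrow> carrier A"
  shows "inv\<^bsub>cochain2_group G A\<^esub> (coboundary1 G A b) = coboundary1 G A (\<lambda>g. inv\<^bsub>A\<^esub> (b g))"
proof -
  have cl: "b x \<in> carrier A" if "x \<in> carrier G" for x
    using b that by auto
  show ?thesis
    unfolding inv_cochain2[OF coboundary1_closed[OF b]]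
    unfolding coboundary1_def by (rule restrict_ext) (auto simp: cl A.inv_mult)
qed

lemma subgroup_coboundaries2: "subgroup (coboundaries2 G A) (cochain2_group G A)"
proof -
  interpret C: comm_group "cochain2_group G A" by (rule comm_group_cochain2)
  show ?thesis
  proof (rule C.subgroupI)
    show "coboundaries2 G A \<subseteq> carrier (cochain2_group G A)"
      by (auto simp: coboundaries2_def coboundary1_closed)
    show "coboundaries2 G A \<noteq> {}"
      by (auto simp: coboundaries2_def)
  next
    fix f assume "f \<in> coboundaries2 G A"
    then obtain b where b: "b \<in> carrier G \<rightarrow> carrier A" "f = coboundary1 G A b"
      by (auto simp: coboundaries2_def)
    then show "inv\<^bsub>cochain2_group G A\<^esub> f \<in> coboundaries2 G A"
      unfolding coboundaries2_def
      by (intro image_eqI[where x = "\<lambda>g. inv\<^bsub>A\<^esub> (b g)"]) (auto simp: coboundary1_inv)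
  next
    fix f f' assume "f \<in> coboundaries2 G A" "f' \<in> coboundaries2 G A"
    then obtain b b' where "b \<in> carrier G \<rightarrow> carrier A" "f = coboundary1 G A b"
      "b' \<in> carrier G \<rightarrow> carrier A" "f' = coboundary1 G A b'"
      by (auto simp: coboundaries2_def)
    then show "f \<otimes>\<^bsub>cochain2_group G A\<^esub> f' \<in> coboundaries2 G A"
      unfolding coboundaries2_def
      by (intro image_eqI[where x = "\<lambda>g. b g \<otimes>\<^bsub>A\<^esub> b' g"]) (auto simp: coboundary1_mult)
  qed
qed

lemma coboundaries2_normal:
  "coboundaries2 G A \<lhd> (cochain2_group G A)\<lparr>carrier := cocycles2 G A\<rparr>"
proof -
  interpret C: comm_group "cochain2_group G A" by (rule comm_group_cochain2)
  interpret Z: comm_group "(cochain2_group G A)\<lparr>carrier := cocycles2 G A\<rparr>"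
    by (rule group.group_comm_groupI[OF subgroup.subgroup_is_group[OF subgroup_cocycles2]])
      (auto simp: cocycles2_iff intro: C.m_comm C.group_axioms)
  have "coboundaries2 G A \<subseteq> cocycles2 G A"
    by (auto simp: coboundaries2_def coboundary1_cocycle)
  then have "subgroup (coboundaries2 G A) ((cochain2_group G A)\<lparr>carrier := cocycles2 G A\<rparr>)"
    by (rule C.subgroup_incl[OF subgroup_coboundaries2 subgroup_cocycles2])
  then show ?thesis by (rule Z.subgroup_imp_normal)
qed

end

locale central_ext =
  fixes A :: "'a monoid" and E :: "'e monoid" and G :: "'g monoid" and i p
  assumes central_extension: "central_extension A E G i p"
begin

sublocale A: comm_group A using central_extension by (simp add: central_extension_def)
sublocale G: group G using central_extension by (simp add: central_extension_def)
sublocale E: group E using central_extension by (simp add: central_extension_def)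
sublocale i: group_hom A E i
  using central_extension by unfold_locales (simp add: central_extension_def)
sublocale p: group_hom E G p
  using central_extension by unfold_locales (simp add: central_extension_def)
sublocale trivial_coefficients G A ..

lemma i_inj: "\<lbrakk>i a = i a'; a \<in> carrier A; a' \<in> carrier A\<rbrakk> \<Longrightarrow> a = a'"
  using central_extension by (auto simp: central_extension_def inj_on_def)

lemma i_central: "\<lbrakk>a \<in> carrier A; x \<in> carrier E\<rbrakk> \<Longrightarrow> x \<otimes>\<^bsub>E\<^esub> i a = i a \<otimes>\<^bsub>E\<^esub> x"
  using central_extension by (simp add: central_extension_def)

lemma p_i: "a \<in> carrier A \<Longrightarrow> p (i a) = \<one>\<^bsub>G\<^esub>"
  using central_extension by (auto simp: central_extension_def kernel_def)

lemma same_image_factor: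
  assumes x: "x \<in> carrier E" and y: "y \<in> carrier E" and "p x = p y"
  obtains a where "a \<in> carrier A" "x = i a \<otimes>\<^bsub>E\<^esub> y"
proof -
  have "x \<otimes>\<^bsub>E\<^esub> inv\<^bsub>E\<^esub> y \<in> kernel E G p"
    using assms by (simp add: kernel_def)
  then obtain a where a: "a \<in> carrier A" "x \<otimes>\<^bsub>E\<^esub> inv\<^bsub>E\<^esub> y = i a"
    using central_extension by (auto simp: central_extension_def)
  have "x = i a \<otimes>\<^bsub>E\<^esub> y"
    using x y by (simp add: a(2)[symmetric] E.m_assoc)
  with a(1) show thesis by (rule that)
qed

text \<open>
  It suffices to require a cochain: the cocycle identity follows from associativity in \<open>E\<close>
  (\<open>factor_set_cocycle\<close>).
\<close>

definition factor_set :: "('g \<Rightarrow> 'e) \<Rightarrow> ('g \<times> 'g \<Rightarrow> 'a) \<Rightarrow> bool" where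
  "factor_set s f \<longleftrightarrow> s \<in> carrier G \<rightarrow> carrier E \<and> (\<forall>g\<in>carrier G. p (s g) = g) \<and>
     f \<in> carrier (cochain2_group G A) \<and>
     (\<forall>g\<in>carrier G. \<forall>h\<in>carrier G. s g \<otimes>\<^bsub>E\<^esub> s h = i (f (g, h)) \<otimes>\<^bsub>E\<^esub> s (g \<otimes>\<^bsub>G\<^esub> h))"

lemma factor_setD:
  assumes "factor_set s f"
  shows "g \<in> carrier G \<Longrightarrow> s g \<in> carrier E" "g \<in> carrier G \<Longrightarrow> p (s g) = g"
    "f \<in> carrier (cochain2_group G A)"
    "\<lbrakk>g \<in> carrier G; h \<in> carrier G\<rbrakk> \<Longrightarrow> f (g, h) \<in> carrier A"
    "\<lbrakk>g \<in> carrier G; h \<in> carrier G\<rbrakk> \<Longrightarrow> s g \<otimes>\<^bsub>E\<^esub> s h = i (f (g, h)) \<otimes>\<^bsub>E\<^esub> s (g \<otimes>\<^bsub>G\<^esub> h)"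
  using assms by (auto simp: factor_set_def intro: cochain2_closed)

text \<open>
  Both sides of the cocycle identity are the central factor that appears when
  \<open>s g \<otimes> s h \<otimes> s k\<close> is rewritten as a multiple of \<open>s (g \<otimes> h \<otimes> k)\<close>, once for each bracketing.
\<close>

lemma factor_set_cocycle:
  assumes f: "factor_set s f"
  shows "f \<in> cocycles2 G A"
  unfolding cocycles2_iff
proof (intro conjI ballI factor_setD(3)[OF f])
  fix g h k assume ghk: "g \<in> carrier G" "h \<in> carrier G" "k \<in> carrier G"
  note s = factor_setD(1)[OF f] and fA = factor_setD(4)[OF f] and mult = factor_setD(5)[OF f]
  let ?t = "s (g \<otimes>\<^bsub>G\<^esub> h \<otimes>\<^bsub>G\<^esub> k)"
  have "s g \<otimes>\<^bsub>E\<^esub> (s h \<otimes>\<^bsub>E\<^esub> s k) = s g \<otimes>\<^bsub>E\<^esub> i (f (h, k)) \<otimes>\<^bsub>E\<^esub> s (h \<otimes>\<^bsub>G\<^esub> k)"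
    using ghk by (simp add: mult s fA E.m_assoc)
  also have "\<dots> = i (f (h, k)) \<otimes>\<^bsub>E\<^esub> (s g \<otimes>\<^bsub>E\<^esub> s (h \<otimes>\<^bsub>G\<^esub> k))"
    using ghk by (simp add: i_central s fA E.m_assoc)
  also have "\<dots> = i (f (h, k) \<otimes>\<^bsub>A\<^esub> f (g, h \<otimes>\<^bsub>G\<^esub> k)) \<otimes>\<^bsub>E\<^esub> ?t"
    using ghk by (simp add: mult s fA E.m_assoc G.m_assoc)
  finally have 1: "s g \<otimes>\<^bsub>E\<^esub> (s h \<otimes>\<^bsub>E\<^esub> s k) = \<dots>" .
  have "s g \<otimes>\<^bsub>E\<^esub> s h \<otimes>\<^bsub>E\<^esub> s k = i (f (g, h)) \<otimes>\<^bsub>E\<^esub> (s (g \<otimes>\<^bsub>G\<^esub> h) \<otimes>\<^bsub>E\<^esub> s k)"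
    using ghk by (simp add: mult[of g h] s fA E.m_assoc)
  also have "\<dots> = i (f (g, h) \<otimes>\<^bsub>A\<^esub> f (g \<otimes>\<^bsub>G\<^esub> h, k)) \<otimes>\<^bsub>E\<^esub> ?t"
    using ghk by (simp add: mult s fA E.m_assoc)
  also have "f (g, h) \<otimes>\<^bsub>A\<^esub> f (g \<otimes>\<^bsub>G\<^esub> h, k) = f (g \<otimes>\<^bsub>G\<^esub> h, k) \<otimes>\<^bsub>A\<^esub> f (g, h)"
    using ghk by (intro A.m_comm) (simp_all add: fA)
  finally have "s g \<otimes>\<^bsub>E\<^esub> s h \<otimes>\<^bsub>E\<^esub> s k = i (f (g \<otimes>\<^bsub>G\<^esub> h, k) \<otimes>\<^bsub>A\<^esub> f (g, h)) \<otimes>\<^bsub>E\<^esub> ?t" .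
  with 1 have "i (f (h, k) \<otimes>\<^bsub>A\<^esub> f (g, h \<otimes>\<^bsub>G\<^esub> k)) \<otimes>\<^bsub>E\<^esub> ?t
      = i (f (g \<otimes>\<^bsub>G\<^esub> h, k) \<otimes>\<^bsub>A\<^esub> f (g, h)) \<otimes>\<^bsub>E\<^esub> ?t"
    using ghk by (simp add: s E.m_assoc del: i.hom_mult)
  then have "i (f (h, k) \<otimes>\<^bsub>A\<^esub> f (g, h \<otimes>\<^bsub>G\<^esub> k)) = i (f (g \<otimes>\<^bsub>G\<^esub> h, k) \<otimes>\<^bsub>A\<^esub> f (g, h))"
    using ghk by (simp add: s fA E.right_cancel del: i.hom_mult)
  then show "f (h, k) \<otimes>\<^bsub>A\<^esub> f (g, h \<otimes>\<^bsub>G\<^esub> k) = f (g \<otimes>\<^bsub>G\<^esub> h, k) \<otimes>\<^bsub>A\<^esub> f (g, h)"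
    using ghk by (intro i_inj) (simp_all add: fA)
qed

lemma extension_class_iff: "f \<in> extension_class A E G i p \<longleftrightarrow> (\<exists>s. factor_set s f)"
proof
  assume "f \<in> extension_class A E G i p"
  then show "\<exists>s. factor_set s f"
    unfolding extension_class_def factor_set_def by (auto simp: cocycles2_iff)
next
  assume "\<exists>s. factor_set s f"
  then obtain s where s: "factor_set s f" ..
  with factor_set_cocycle[OF s] show "f \<in> extension_class A E G i p"
    unfolding extension_class_def factor_set_def by blast
qed

lemma factor_set_exists: "\<exists>s f. factor_set s f"
proof -
  have "p ` carrier E = carrier G"
    using central_extension by (simp add: central_extension_def)
  then have "\<exists>x. x \<in> carrier E \<and> p x = g" if "g \<in> carrier G" for g
    using that by (metis imageE)
  then obtain s where s: "\<forall>g\<in>carrier G. s g \<in> carrier E \<and> p (s g) = g"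
    by metis
  have ex: "\<exists>a. a \<in> carrier A \<and> s g \<otimes>\<^bsub>E\<^esub> s h = i a \<otimes>\<^bsub>E\<^esub> s (g \<otimes>\<^bsub>G\<^esub> h)"
    if gh: "g \<in> carrier G" "h \<in> carrier G" for g h
  proof -
    have "s g \<in> carrier E" "s h \<in> carrier E" "s (g \<otimes>\<^bsub>G\<^esub> h) \<in> carrier E"
      "p (s g) = g" "p (s h) = h" "p (s (g \<otimes>\<^bsub>G\<^esub> h)) = g \<otimes>\<^bsub>G\<^esub> h"
      using gh s by simp_all
    then obtain a where "a \<in> carrier A" "s g \<otimes>\<^bsub>E\<^esub> s h = i a \<otimes>\<^bsub>E\<^esub> s (g \<otimes>\<^bsub>G\<^esub> h)"
      using gh same_image_factor[of "s g \<otimes>\<^bsub>E\<^esub> s h" "s (g \<otimes>\<^bsub>G\<^esub> h)" thesis] by simp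
    then show ?thesis by blast
  qed
  define c where "c g h = (SOME a. a \<in> carrier A \<and> s g \<otimes>\<^bsub>E\<^esub> s h = i a \<otimes>\<^bsub>E\<^esub> s (g \<otimes>\<^bsub>G\<^esub> h))"
    for g h
  have c: "c g h \<in> carrier A \<and> s g \<otimes>\<^bsub>E\<^esub> s h = i (c g h) \<otimes>\<^bsub>E\<^esub> s (g \<otimes>\<^bsub>G\<^esub> h)"
    if "g \<in> carrier G" "h \<in> carrier G" for g h
    unfolding c_def by (rule someI_ex[OF ex[OF that]])
  have "(\<lambda>(g, h)\<in>carrier G \<times> carrier G. c g h) \<in> carrier (cochain2_group G A)"
    using c by (auto simp: carrier_cochain2)
  then have "factor_set s (\<lambda>(g, h)\<in>carrier G \<times> carrier G. c g h)"
    using s c by (simp add: factor_set_def Pi_iff)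
  then show ?thesis by blast
qed

text \<open>
  Translating a section by \<open>i \<circ> b\<close> multiplies its factor set by the coboundary of \<open>b\<close>, because the
  values of \<open>i\<close> can be moved past those of \<open>s\<close>.
\<close>

lemma factor_set_change_section:
  assumes f: "factor_set s f" and b: "b \<in> carrier G \<rightarrow> carrier A"
  shows "factor_set (\<lambda>g. i (b g) \<otimes>\<^bsub>E\<^esub> s g) (coboundary1 G A b \<otimes>\<^bsub>cochain2_group G A\<^esub> f)"
proof -
  interpret C: comm_group "cochain2_group G A" by (rule comm_group_cochain2)
  note s = factor_setD(1,2)[OF f] and fA = factor_setD(4)[OF f] and mult = factor_setD(5)[OF f]
  have bA: "b g \<in> carrier A" if "g \<in> carrier G" for g
    using b that by auto
  have "(i (b g) \<otimes>\<^bsub>E\<^esub> s g) \<otimes>\<^bsub>E\<^esub> (i (b h) \<otimes>\<^bsub>E\<^esub> s h)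
      = i (coboundary1 G A b (g, h) \<otimes>\<^bsub>A\<^esub> f (g, h)) \<otimes>\<^bsub>E\<^esub> (i (b (g \<otimes>\<^bsub>G\<^esub> h)) \<otimes>\<^bsub>E\<^esub> s (g \<otimes>\<^bsub>G\<^esub> h))"
    if gh: "g \<in> carrier G" "h \<in> carrier G" for g h
  proof -
    let ?z = "b g \<otimes>\<^bsub>A\<^esub> b h \<otimes>\<^bsub>A\<^esub> f (g, h)"
    have "(i (b g) \<otimes>\<^bsub>E\<^esub> s g) \<otimes>\<^bsub>E\<^esub> (i (b h) \<otimes>\<^bsub>E\<^esub> s h)
        = i (b g) \<otimes>\<^bsub>E\<^esub> (s g \<otimes>\<^bsub>E\<^esub> i (b h)) \<otimes>\<^bsub>E\<^esub> s h"
      using gh by (simp add: s bA E.m_assoc)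
    also have "\<dots> = i (b g \<otimes>\<^bsub>A\<^esub> b h) \<otimes>\<^bsub>E\<^esub> (s g \<otimes>\<^bsub>E\<^esub> s h)"
      using gh by (simp add: i_central[of "b h" "s g"] s bA E.m_assoc)
    also have "\<dots> = i ?z \<otimes>\<^bsub>E\<^esub> s (g \<otimes>\<^bsub>G\<^esub> h)"
      using gh by (simp add: mult s bA fA E.m_assoc)
    \<comment> \<open>inserting the value of \<open>b\<close> at the product makes the translated section appear on the right\<close>
    also have "?z = ?z \<otimes>\<^bsub>A\<^esub> (inv\<^bsub>A\<^esub> (b (g \<otimes>\<^bsub>G\<^esub> h)) \<otimes>\<^bsub>A\<^esub> b (g \<otimes>\<^bsub>G\<^esub> h))"
      using gh by (simp add: bA fA)
    also have "\<dots> = (coboundary1 G A b (g, h) \<otimes>\<^bsub>A\<^esub> f (g, h)) \<otimes>\<^bsub>A\<^esub> b (g \<otimes>\<^bsub>G\<^esub> h)"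
      using gh by (simp add: bA fA A.m_ac del: A.l_inv A.Units_l_inv A.r_inv A.Units_r_inv)
    finally show ?thesis
      using gh by (simp add: bA fA s E.m_assoc del: A.l_inv)
  qed
  then show ?thesis
    unfolding factor_set_def
    by (auto simp: bA s p_i mult_cochain2 C.m_closed[unfolded mult_cochain2]
        coboundary1_closed[OF b] factor_setD(3)[OF f])
qed

lemma factor_set_unique:
  assumes "factor_set s f" "factor_set s f'"
  shows "f = f'"
proof -
  have "f (g, h) = f' (g, h)" if gh: "g \<in> carrier G" "h \<in> carrier G" for g h
  proof -
    have "i (f (g, h)) \<otimes>\<^bsub>E\<^esub> s (g \<otimes>\<^bsub>G\<^esub> h) = i (f' (g, h)) \<otimes>\<^bsub>E\<^esub> s (g \<otimes>\<^bsub>G\<^esub> h)"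
      using gh factor_setD(5)[OF assms(1)] factor_setD(5)[OF assms(2)] by metis
    then have "i (f (g, h)) = i (f' (g, h))"
      using gh by (simp add: factor_setD[OF assms(1)] factor_setD[OF assms(2)] E.right_cancel)
    then show ?thesis
      using gh by (intro i_inj factor_setD(4)[OF assms(1)] factor_setD(4)[OF assms(2)])
  qed
  then show ?thesis
    using factor_setD(3)[OF assms(1)] factor_setD(3)[OF assms(2)]
    unfolding carrier_cochain2 by (intro PiE_ext) auto
qed

text \<open>
  Any two sections differ by a translation by some \<open>i \<circ> b\<close>, so the factor sets of all sections
  are exactly those obtained from one of them by multiplying with coboundaries.
\<close>

theorem extension_class_eq_coset:
  assumes f: "f \<in> extension_class A E G i p"
  shows "extension_class A E G i p = coboundaries2 G A #>\<^bsub>cochain2_group G A\<^esub> f"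
proof -
  obtain s where s: "factor_set s f"
    using f by (auto simp: extension_class_iff)
  have "f' \<in> extension_class A E G i p \<longleftrightarrow>
    (\<exists>b\<in>carrier G \<rightarrow> carrier A. f' = coboundary1 G A b \<otimes>\<^bsub>cochain2_group G A\<^esub> f)" for f'
  proof
    assume "f' \<in> extension_class A E G i p"
    then obtain s' where s': "factor_set s' f'"
      by (auto simp: extension_class_iff)
    have "\<exists>a. a \<in> carrier A \<and> s' g = i a \<otimes>\<^bsub>E\<^esub> s g" if "g \<in> carrier G" for g
    proof -
      from that have "s' g \<in> carrier E" "s g \<in> carrier E" "p (s' g) = p (s g)"
        by (simp_all add: factor_setD(1,2)[OF s] factor_setD(1,2)[OF s'])
      then obtain a where "a \<in> carrier A" "s' g = i a \<otimes>\<^bsub>E\<^esub> s g"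
        by (rule same_image_factor)
      then show ?thesis by blast
    qed
    then obtain b where b: "\<And>g. g \<in> carrier G \<Longrightarrow> b g \<in> carrier A"
        "\<And>g. g \<in> carrier G \<Longrightarrow> i (b g) \<otimes>\<^bsub>E\<^esub> s g = s' g"
      by metis
    then have b': "b \<in> carrier G \<rightarrow> carrier A" by auto
    have "factor_set (\<lambda>g. i (b g) \<otimes>\<^bsub>E\<^esub> s g) f'"
      using s' unfolding factor_set_def by (simp add: b(2) Pi_iff)
    with factor_set_change_section[OF s b'] b' factor_set_unique
    show "\<exists>b\<in>carrier G \<rightarrow> carrier A. f' = coboundary1 G A b \<otimes>\<^bsub>cochain2_group G A\<^esub> f"
      by blast
  next
    assume "\<exists>b\<in>carrier G \<rightarrow> carrier A. f' = coboundary1 G A b \<otimes>\<^bsub>cochain2_group G A\<^esub> f"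
    then show "f' \<in> extension_class A E G i p"
      using factor_set_change_section[OF s] by (auto simp: extension_class_iff)
  qed
  then show ?thesis
    by (auto simp: r_coset_def coboundaries2_def)
qed

lemma extension_class_eq_cocycle_coset:
  assumes "f \<in> extension_class A E G i p"
  shows "extension_class A E G i p
    = coboundaries2 G A #>\<^bsub>(cochain2_group G A)\<lparr>carrier := cocycles2 G A\<rparr>\<^esub> f"
  using extension_class_eq_coset[OF assms] by (simp add: r_coset_def)

corollary extension_class_in_H2: "extension_class A E G i p \<in> carrier (H2 G A)"
proof -
  obtain s f where f: "factor_set s f"
    using factor_set_exists by blast
  then have "f \<in> extension_class A E G i p"
    by (auto simp: extension_class_iff)
  from extension_class_eq_cocycle_coset[OF this] factor_set_cocycle[OF f] show ?thesis
    by (auto simp: H2_def carrier_FactGroup)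
qed

end

text \<open>
  Naturality of the class in the coefficients, for the endomorphism \<open>a \<mapsto> a\<^sup>n\<close> of \<open>A\<close>: if \<open>s\<close> is a
  section of \<open>p\<close> with factor set \<open>f\<close>, then \<open>\<phi> \<circ> s\<close> is a section of \<open>p'\<close> with factor set \<open>f\<^sup>n\<close>.
\<close>

theorem extension_class_power:
  assumes "central_extension A E G i p" and "central_extension A E' G i' p'"
    and \<phi>: "\<phi> \<in> hom E E'"
    and over: "\<And>x. x \<in> carrier E \<Longrightarrow> p' (\<phi> x) = p x"
    and kern: "\<And>a. a \<in> carrier A \<Longrightarrow> \<phi> (i a) = i' (a [^]\<^bsub>A\<^esub> n)"
  shows "extension_class A E' G i' p' = extension_class A E G i p [^]\<^bsub>H2 G A\<^esub> (n::nat)"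
proof -
  interpret X: central_ext A E G i p by unfold_locales fact
  interpret Y: central_ext A E' G i' p' by unfold_locales fact
  interpret C: comm_group "cochain2_group G A" by (rule X.comm_group_cochain2)
  interpret B: normal "coboundaries2 G A" "(cochain2_group G A)\<lparr>carrier := cocycles2 G A\<rparr>"
    by (rule X.coboundaries2_normal)
  interpret \<phi>: group_hom E E' \<phi> by unfold_locales fact
  obtain s f where f: "X.factor_set s f"
    using X.factor_set_exists by blast
  note fC = X.factor_setD(3)[OF f]
  let ?fn = "f [^]\<^bsub>cochain2_group G A\<^esub> n"
  have "Y.factor_set (\<lambda>g. \<phi> (s g)) ?fn"
    unfolding Y.factor_set_def
  proof (intro conjI ballI)
    fix g h assume gh: "g \<in> carrier G" "h \<in> carrier G"
    have "\<phi> (s g) \<otimes>\<^bsub>E'\<^esub> \<phi> (s h) = \<phi> (s g \<otimes>\<^bsub>E\<^esub> s h)"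
      using gh by (simp add: X.factor_setD(1)[OF f])
    also have "\<dots> = \<phi> (i (f (g, h)) \<otimes>\<^bsub>E\<^esub> s (g \<otimes>\<^bsub>G\<^esub> h))"
      using gh by (simp only: X.factor_setD(5)[OF f])
    also have "\<dots> = i' (?fn (g, h)) \<otimes>\<^bsub>E'\<^esub> \<phi> (s (g \<otimes>\<^bsub>G\<^esub> h))"
      using gh by (simp add: X.factor_setD[OF f] kern X.pow_cochain2[OF fC])
    finally show "\<phi> (s g) \<otimes>\<^bsub>E'\<^esub> \<phi> (s h) = i' (?fn (g, h)) \<otimes>\<^bsub>E'\<^esub> \<phi> (s (g \<otimes>\<^bsub>G\<^esub> h))" .
  qed (use fC in \<open>auto simp: X.factor_setD[OF f] over\<close>)
  then have "?fn \<in> extension_class A E' G i' p'"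
    by (auto simp: Y.extension_class_iff)
  then have "extension_class A E' G i' p'
      = coboundaries2 G A #>\<^bsub>(cochain2_group G A)\<lparr>carrier := cocycles2 G A\<rparr>\<^esub> ?fn"
    by (rule Y.extension_class_eq_cocycle_coset)
  also have "\<dots> = (coboundaries2 G A #>\<^bsub>(cochain2_group G A)\<lparr>carrier := cocycles2 G A\<rparr>\<^esub> f) [^]\<^bsub>H2 G A\<^esub> n"
    using X.factor_set_cocycle[OF f] B.FactGroup_pow[of f n]
    by (simp add: H2_def C.nat_pow_consistent[symmetric])
  also have "coboundaries2 G A #>\<^bsub>(cochain2_group G A)\<lparr>carrier := cocycles2 G A\<rparr>\<^esub> f
      = extension_class A E G i p"
    using f by (intro X.extension_class_eq_cocycle_coset[symmetric]) (auto simp: X.extension_class_iff)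
  finally show ?thesis .
qed

section \<open>The classes of the extensions of the torus mapping class group\<close>

theorem ext_class_power: "ext_class m l = ext_class 1 l [^]\<^bsub>H2 \<Gamma>1 (integer_mod_group l)\<^esub> m"
proof -
  obtain \<phi> where \<phi>: "\<phi> \<in> hom (ext_group 1 l) (ext_group m l)"
    "\<And>X. X \<in> carrier (ext_group 1 l) \<Longrightarrow> ext_proj (\<phi> X) = ext_proj X"
    "\<And>k. \<phi> (ext_incl 1 l k) = ext_incl m l (int m * k)"
    using ext_group_power_hom[where l = l and m = m] by blast
  show ?thesis
    by (rule extension_class_power[OF central_extension_ext_group central_extension_ext_group \<phi>(1,2)])
      (simp_all only: \<phi>(3) pow_integer_mod_group ext_incl_mod)
qed

theorem proposition4p14:
  fixes scale :: "'k::alg_closed_field \<Rightarrow> 'h::ring_1 \<Rightarrow> 'h"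
    and \<Delta> :: "'h \<Rightarrow> ('h \<times> 'h) multiset"
    and \<epsilon> :: "'h \<Rightarrow> 'k"
    and S :: "'h \<Rightarrow> 'h"
    and R :: "('h \<times> 'h) multiset"
    and v :: 'h
    and lam :: "'h \<Rightarrow> 'k"
    and l0 :: nat
  assumes "factorizable_ribbon_hopf_algebra scale \<Delta> \<epsilon> S R v"
    and "fd_hopf_algebra.nonzero_left_integral scale \<Delta> lam"
    and "l0 = group.ord unit_group ((lam (ring_inverse v) / lam v)\<^sup>2)"
  shows "central_extension (integer_mod_group l0) (ext_group 2 l0) \<Gamma>1 (ext_incl 2 l0) ext_proj \<and>
     central_extension (integer_mod_group l0) (ext_group 1 l0) \<Gamma>1 (ext_incl 1 l0) ext_proj \<and>
     ext_class 2 l0 \<in> carrier (H2 \<Gamma>1 (integer_mod_group l0)) \<and>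
     ext_class 1 l0 \<in> carrier (H2 \<Gamma>1 (integer_mod_group l0)) \<and>
     ext_class 2 l0 = ext_class 1 l0 [^]\<^bsub>H2 \<Gamma>1 (integer_mod_group l0)\<^esub> (2::nat)"
proof -
  have "ext_class m l \<in> carrier (H2 \<Gamma>1 (integer_mod_group l))" for m l
  proof -
    interpret central_ext "integer_mod_group l" "ext_group m l" \<Gamma>1 "ext_incl m l" ext_proj
      by unfold_locales (rule central_extension_ext_group)
    show ?thesis by (rule extension_class_in_H2)
  qed
  then show ?thesis
    by (intro conjI central_extension_ext_group ext_class_power)
qed

end
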